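(* Let $K_1, K_2$ be compact Hausdorff spaces and let $E$ be a Banach space. Assume that there exists an isomorphic embedding $T:\mathcal{C}(K_1)\to\mathcal{C}(K_2,E)$ with $\|T\|\,\|T^{-1}\|<3$. Then for each ordinal $\alpha$ such that $K_1^{(\alpha)}$ is infinite the following hold. (i) If $E$ has nontrivial cotype, then $c_{\text{pb}}(K_1^{(\alpha)},K_1)\le c_{\text{pb}}(K_2^{(\alpha)},K_2)$ and $s(K_1^{(\alpha)})\le s(K_2^{(\alpha)})$. (ii) If $E$ does not contain an isomorphic copy of $c_0$, then $c_{\text{pb}}(K_1^{(\alpha)},K_1)\le c_{\text{pf}}(K_2^{(\alpha)},K_2)$.
   Context: For a compact space $K$ and a Banach space $E$, $\mathcal{C}(K,E)$ is the Banach space of continuous functions $K\to E$ with the sup-norm, and $\mathcal{C}(K)=\mathcal{C}(K,\mathbb{R})$. An isomorphic embedding $T$ is a bounded linear map that is an isomorphism onto its range; $T^{-1}$ denotes the inverse defined on the range of $T$. Cantor-Bendixson derivatives: $X^{(0)}=X$, $X^{(1)}$ is the set of accumulation points of $X$, $X^{(\beta+1)}=(X^{(\beta)})^{(1)}$, and $X^{(\alpha)}=\bigcap_{\beta<\alpha}X^{(\beta)}$ for limit ordinals $\alpha$. A family $\mathcal{U}$ of nonempty subsets of a topological space $X$ is point-bounded if there is $k\in\mathbb{N}$ such that every $x\in X$ lies in at most $k$ sets from $\mathcal{U}$; it is point-finite if every $x\in X$ lies in only finitely many sets from $\mathcal{U}$. The family $\mathcal{U}$ is meeting $A\subseteq X$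 if $A\cap U\ne\emptyset$ for each $U\in\mathcal{U}$. For $A\subseteq X$, $c_{\text{pb}}(A,X)$ (resp. $c_{\text{pf}}(A,X)$) is the supremum of the cardinalities $|\mathcal{U}|$ over all point-bounded (resp. point-finite) families $\mathcal{U}$ of nonempty open subsets of $X$ that are meeting $A$. The spread of $A$ is $s(A)=\sup\{|D|: D\subseteq A,\ D\text{ is discrete in the inherited topology}\}$. A Banach space $E$ has nontrivial cotype if there are a real number $q\ge 2$ and a constant $C>0$ such that for all $n\in\mathbb{N}$ and $e_1,\dots,e_n\in E$, $\left(\sum_{i=1}^n\|e_i\|^q\right)^{1/q}\le C\left(\int_0^1\left\|\sum_{i=1}^n r_i(t)e_i\right\|^2dt\right)^{1/2}$, where $r_i(t)=\operatorname{sign}(\sin(2^i\pi t))$ are the Rademacher functions. *)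

theory Defs
  imports "HOL-Analysis.Analysis"
begin

unbundle cardinal_syntax

section \<open>Cantor-Bendixson derivatives\<close>

text \<open>
  The accumulation points of S as a topological space in its own right, hence points of S.
\<close>

definition acc_points :: "'a::topological_space set \<Rightarrow> 'a set"
  where "acc_points S = {x \<in> S. x islimpt S}"

text \<open>
  An ordinal is represented by an element \<open>\<alpha>\<close> of a type of class \<^class>\<open>wellorder\<close>, standing for
  the order type of its set of predecessors \<open>{..<\<alpha>}\<close>. Every ordinal arises in this way, since the
  type is arbitrary.
\<close>

definition ord_succ :: "'o::wellorder \<Rightarrow> 'o \<Rightarrow> bool"
  where "ord_succ \<beta> \<alpha> \<longleftrightarrow> \<beta> < \<alpha> \<and> (\<forall>\<gamma><\<alpha>. \<gamma> \<le> \<beta>)"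

lemma ord_succ_unique: "ord_succ \<beta> \<alpha> \<Longrightarrow> ord_succ \<gamma> \<alpha> \<Longrightarrow> \<gamma> = \<beta>"
  by (auto simp: ord_succ_def intro: antisym)

lemma The_ord_succ: "ord_succ \<beta> \<alpha> \<Longrightarrow> (THE \<beta>. ord_succ \<beta> \<alpha>) = \<beta>"
  using ord_succ_unique by blast

function cb_deriv :: "'a::topological_space set \<Rightarrow> 'o::wellorder \<Rightarrow> 'a set" where
  "cb_deriv X \<alpha> =
     (if \<forall>\<beta>. \<alpha> \<le> \<beta> then X
      else if \<exists>\<beta>. ord_succ \<beta> \<alpha> then acc_points (cb_deriv X (THE \<beta>. ord_succ \<beta> \<alpha>))
      else (\<Inter>\<beta>\<in>{..<\<alpha>}. cb_deriv X \<beta>))"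
  by pat_completeness auto
termination
  by (relation "inv_image {(x, y). x < y} snd")
    (auto intro: wf_inv_image wf simp: The_ord_succ, auto simp: ord_succ_def)

declare cb_deriv.simps [simp del]

lemma cb_deriv_zero: "(\<And>\<beta>. \<alpha> \<le> \<beta>) \<Longrightarrow> cb_deriv X \<alpha> = X"
  by (subst cb_deriv.simps) simp

lemma cb_deriv_succ:
  assumes "ord_succ \<beta> \<alpha>"
  shows "cb_deriv X \<alpha> = acc_points (cb_deriv X \<beta>)"
proof -
  have "\<not> (\<forall>\<beta>. \<alpha> \<le> \<beta>)"
    using assms by (auto simp: ord_succ_def not_le)
  then show ?thesis
    using assms by (subst cb_deriv.simps) (auto simp: The_ord_succ)
qed

lemma cb_deriv_limit:
  assumes "\<gamma> < \<alpha>" "\<And>\<beta>. \<not> ord_succ \<beta> \<alpha>"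
  shows "cb_deriv X \<alpha> = (\<Inter>\<beta>\<in>{..<\<alpha>}. cb_deriv X \<beta>)"
proof -
  have "\<not> (\<forall>\<beta>. \<alpha> \<le> \<beta>)"
    using assms(1) by (auto simp: not_le)
  then show ?thesis
    using assms(2) by (subst cb_deriv.simps) auto
qed


section \<open>Suprema of cardinalities\<close>

text \<open>
  The supremum, in the class of all cardinals, of the cardinalities of the members of \<open>F\<close>,
  represented by a cardinal order. It is chosen among the cardinal orders on \<open>'b\<close>; by
  \<open>card_Sup_le_iff\<close> below it is the least upper bound among all cardinals.
\<close>

definition is_card_Sup :: "'b set set \<Rightarrow> 'b rel \<Rightarrow> bool"
  where "is_card_Sup F r \<longleftrightarrow>
    Card_order r \<and> (\<forall>A\<in>F. |A| \<le>o r) \<and>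
    (\<forall>r' :: 'b rel. Card_order r' \<and> (\<forall>A\<in>F. |A| \<le>o r') \<longrightarrow> r \<le>o r')"

definition card_Sup :: "'b set set \<Rightarrow> 'b rel"
  where "card_Sup F = (SOME r. is_card_Sup F r)"

lemma is_card_Sup_card_Sup:
  fixes F :: "'b set set"
  shows "is_card_Sup F (card_Sup F)"
proof -
  let ?R = "{r :: 'b rel. Card_order r \<and> (\<forall>A\<in>F. |A| \<le>o r)}"
  have "|UNIV :: 'b set| \<in> ?R"
    by (simp add: card_of_Card_order card_of_mono1)
  then have "\<exists>r\<in>?R. \<forall>r'\<in>?R. r \<le>o r'"
    by (intro exists_minim_Card_order) auto
  then have "\<exists>r. is_card_Sup F r"
    by (auto simp: is_card_Sup_def)
  then show ?thesis
    unfolding card_Sup_def by (rule someI_ex)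
qed

lemma Card_order_card_Sup: "Card_order (card_Sup F)"
  using is_card_Sup_card_Sup[of F] by (simp add: is_card_Sup_def)

lemma card_Sup_upper: "A \<in> F \<Longrightarrow> |A| \<le>o card_Sup F"
  using is_card_Sup_card_Sup[of F] by (simp add: is_card_Sup_def)

lemma card_Sup_le_iff:
  fixes F :: "'b set set" and r :: "'c rel"
  assumes r: "Card_order r"
  shows "card_Sup F \<le>o r \<longleftrightarrow> (\<forall>A\<in>F. |A| \<le>o r)"
proof
  assume "card_Sup F \<le>o r"
  then show "\<forall>A\<in>F. |A| \<le>o r"
    using card_Sup_upper ordLeq_transitive by blast
next
  assume ub: "\<forall>A\<in>F. |A| \<le>o r"
  show "card_Sup F \<le>o r"
  proof (cases "|UNIV :: 'b set| \<le>o r")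
    case True
    have "card_Sup F \<le>o |UNIV :: 'b set|"
      using is_card_Sup_card_Sup[of F] card_of_Card_order[of "UNIV :: 'b set"]
      by (simp add: is_card_Sup_def card_of_mono1)
    then show ?thesis
      using True by (rule ordLeq_transitive)
  next
    case False
    then have "r \<le>o |UNIV :: 'b set|"
      using ordLeq_total[OF card_of_Well_order[of "UNIV :: 'b set"], of r] r
      by (auto simp: card_order_on_well_order_on)
    then have "|Field r| \<le>o |UNIV :: 'b set|"
      using card_of_Field_ordIso[OF r] ordIso_ordLeq_trans by blast
    then obtain f where f: "inj_on f (Field r)" "f ` Field r \<subseteq> (UNIV :: 'b set)"
      by (subst (asm) card_of_ordLeq[symmetric]) blast
    then have "|Field r| =o |f ` Field r|"
      by (meson card_of_ordIsoI inj_on_imp_bij_betw)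
    then have iso: "r =o |f ` Field r|"
      using card_of_Field_ordIso[OF r] ordIso_symmetric ordIso_transitive by blast
    then have "\<forall>A\<in>F. |A| \<le>o |f ` Field r|"
      using ub ordLeq_ordIso_trans by blast
    then have "card_Sup F \<le>o |f ` Field r|"
      using is_card_Sup_card_Sup[of F] card_of_Card_order by (auto simp: is_card_Sup_def)
    then show ?thesis
      using iso ordIso_symmetric ordLeq_ordIso_trans by blast
  qed
qed


section \<open>The cardinal functions\<close>

text \<open>The ambient space X is the whole type \<open>'a\<close>.\<close>

definition point_bounded :: "'a set set \<Rightarrow> bool"
  where "point_bounded \<U> \<longleftrightarrow>
    (\<exists>k::nat. \<forall>x. finite {U \<in> \<U>. x \<in> U} \<and> card {U \<in> \<U>. x \<in> U} \<le> k)"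

definition point_finite :: "'a set set \<Rightarrow> bool"
  where "point_finite \<U> \<longleftrightarrow> (\<forall>x. finite {U \<in> \<U>. x \<in> U})"

definition meeting :: "'a set set \<Rightarrow> 'a set \<Rightarrow> bool"
  where "meeting \<U> A \<longleftrightarrow> (\<forall>U\<in>\<U>. A \<inter> U \<noteq> {})"

definition c_pb :: "'a::topological_space set \<Rightarrow> 'a set rel"
  where "c_pb A =
    card_Sup {\<U>. point_bounded \<U> \<and> (\<forall>U\<in>\<U>. open U \<and> U \<noteq> {}) \<and> meeting \<U> A}"

definition c_pf :: "'a::topological_space set \<Rightarrow> 'a set rel"
  where "c_pf A =
    card_Sup {\<U>. point_finite \<U> \<and> (\<forall>U\<in>\<U>. open U \<and> U \<noteq> {}) \<and> meeting \<U> A}"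

definition spread :: "'a::topological_space set \<Rightarrow> 'a rel"
  where "spread A = card_Sup {D. D \<subseteq> A \<and> discrete D}"


section \<open>Isomorphic embeddings, cotype and copies of c0\<close>

definition isomorphic_embedding :: "('a::real_normed_vector \<Rightarrow> 'b::real_normed_vector) \<Rightarrow> bool"
  where "isomorphic_embedding T \<longleftrightarrow>
    bounded_linear T \<and> inj T \<and> (\<exists>B. \<forall>y\<in>range T. norm (inv T y) \<le> B * norm y)"

text \<open>
  The operator norm of the inverse of T on the range of T, in the form in which \<^const>\<open>onorm\<close> is
  defined for maps on a whole type.
\<close>

definition onorm_inverse :: "('a::real_normed_vector \<Rightarrow> 'b::real_normed_vector) \<Rightarrow> real"
  where "onorm_inverse T = (SUP y\<in>range T. norm (inv T y) / norm y)"

definition rademacher :: "nat \<Rightarrow> real \<Rightarrow> real"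
  where "rademacher i t = sgn (sin (2 ^ i * pi * t))"

definition nontrivial_cotype :: "'e::real_normed_vector itself \<Rightarrow> bool"
  where "nontrivial_cotype _ \<longleftrightarrow>
    (\<exists>q::real. \<exists>C::real. 2 \<le> q \<and> 0 < C \<and>
      (\<forall>(n::nat) (e :: nat \<Rightarrow> 'e).
        (\<Sum>i=1..n. norm (e i) powr q) powr (1 / q) \<le>
        C * sqrt (integral {0..1} (\<lambda>t. (norm (\<Sum>i=1..n. rademacher i t *\<^sub>R e i))\<^sup>2))))"

text \<open>
  Since \<^typ>\<open>nat\<close> is discrete, \<^typ>\<open>nat \<Rightarrow>\<^sub>C real\<close> is the space of all bounded real sequences with
  the sup-norm.
\<close>

typedef c0 = "{f :: nat \<Rightarrow>\<^sub>C real. apply_bcontfun f \<longlonglongrightarrow> 0}"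
  by (rule exI[of _ 0]) simp

setup_lifting type_definition_c0

instantiation c0 :: real_normed_vector
begin

lift_definition zero_c0 :: c0 is 0 by simp
lift_definition plus_c0 :: "c0 \<Rightarrow> c0 \<Rightarrow> c0" is "(+)" by (auto intro: tendsto_add_zero)
lift_definition minus_c0 :: "c0 \<Rightarrow> c0 \<Rightarrow> c0" is "(-)"
  using tendsto_diff[where a = "0::real" and b = 0] by fastforce
lift_definition uminus_c0 :: "c0 \<Rightarrow> c0" is uminus
  using tendsto_minus[where a = "0::real"] by fastforce
lift_definition scaleR_c0 :: "real \<Rightarrow> c0 \<Rightarrow> c0" is "scaleR" by (auto intro: tendsto_mult_right_zero)
lift_definition norm_c0 :: "c0 \<Rightarrow> real" is norm .
lift_definition dist_c0 :: "c0 \<Rightarrow> c0 \<Rightarrow> real" is dist .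
lift_definition sgn_c0 :: "c0 \<Rightarrow> c0" is sgn
  by (auto simp: sgn_bcontfun_def intro: tendsto_mult_right_zero)

definition uniformity_c0 :: "(c0 \<times> c0) filter"
  where "uniformity_c0 = (INF e\<in>{0<..}. principal {(x, y). dist x y < e})"

definition open_c0 :: "c0 set \<Rightarrow> bool"
  where "open_c0 S = (\<forall>x\<in>S. \<forall>\<^sub>F (x', y) in uniformity. x' = x \<longrightarrow> y \<in> S)"

instance
proof
  fix x y z :: c0 and a b :: real
  show "x + y + z = x + (y + z)" by transfer simp
  show "x + y = y + x" by transfer simp
  show "0 + x = x" by transfer simp
  show "- x + x = 0" by transfer simp
  show "x - y = x + - y" by transfer simp
  show "a *\<^sub>R (x + y) = a *\<^sub>R x + a *\<^sub>R y" by transfer (rule scaleR_add_right)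
  show "(a + b) *\<^sub>R x = a *\<^sub>R x + b *\<^sub>R x" by transfer (rule scaleR_add_left)
  show "a *\<^sub>R b *\<^sub>R x = (a * b) *\<^sub>R x" by transfer simp
  show "1 *\<^sub>R x = x" by transfer simp
  show "dist x y = norm (x - y)" by transfer (rule dist_norm)
  show "sgn x = inverse (norm x) *\<^sub>R x" by transfer (rule sgn_div_norm)
  show "norm x = 0 \<longleftrightarrow> x = 0" by transfer simp
  show "norm (x + y) \<le> norm x + norm y" by transfer (rule norm_triangle_ineq)
  show "norm (a *\<^sub>R x) = \<bar>a\<bar> * norm x" by transfer simp
qed (rule uniformity_c0_def open_c0_def)+

end

definition contains_c0 :: "'e::real_normed_vector itself \<Rightarrow> bool"
  where "contains_c0 _ \<longleftrightarrow> (\<exists>S :: c0 \<Rightarrow> 'e. isomorphic_embedding S)"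

end

theory Submission
  imports Defs
begin

text \<open>
  Let \<open>\<parallel>f\<parallel> \<le> L \<parallel>T f\<parallel>\<close>, \<open>\<parallel>T f\<parallel> \<le> M \<parallel>f\<parallel>\<close> with \<open>L M < 3\<close>. To every point \<open>x\<close> of \<open>K\<^sub>1\<close> belongs
  the closed set of all \<open>y\<close> at which \<open>\<parallel>T f (y)\<parallel> \<ge> \<delta>\<close> for each \<open>f\<close> with \<open>0 \<le> f \<le> 1\<close> that equals 1
  near \<open>x\<close>. Distortion below 3 makes this set nonempty for a fixed \<open>\<delta> > 0\<close>, and if \<open>E\<close> does not
  contain \<open>c\<^sub>0\<close>, a point \<open>y\<close> belongs to only finitely many \<open>x\<close>. By transfinite induction and
  compactness the set of a point of \<open>K\<^sub>1\<^sup>(\<^sup>\<alpha>\<^sup>)\<close> therefore meets \<open>K\<^sub>2\<^sup>(\<^sup>\<alpha>\<^sup>)\<close>.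

  A point-bounded family \<open>\<U>\<close> is transported by choosing bumps \<open>f\<^sub>U\<close> in the sets \<open>U\<close> and taking the sets
  \<open>{y. \<parallel>T f\<^sub>U (y)\<parallel> > \<delta>/2}\<close>. At a fixed \<open>y\<close> the series of the \<open>T f\<^sub>U (y)\<close> is weakly unconditionally
  Cauchy, which limits the number of large terms, by the theorem of Bessaga and Pelczynski or by
  cotype. For a discrete set the bumps overlap without control. There the total \<open>q\<close>-variation of
  \<open>f \<mapsto> T f (y)\<close> away from the discrete set is made nearly constant by the pigeonhole principle, so that
  only charges at the points themselves matter, and these are separated by a free set argument.
\<close>

section \<open>Copies of c0 and cotype\<close>

definition sublinear :: "('a::real_vector \<Rightarrow> real) \<Rightarrow> bool"
  where "sublinear p \<longleftrightarrow>
    (\<forall>x y. p (x + y) \<le> p x + p y) \<and> (\<forall>c x. 0 \<le> c \<longrightarrow> p (c *\<^sub>R x) = c * p x)"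

lemma sublinear_zero: "sublinear p \<Longrightarrow> p 0 = 0"
  unfolding sublinear_def by (metis mult_zero_left order_refl scaleR_zero_left)

lemma sublinear_ge_uminus:
  assumes "sublinear p" shows "- p (- x) \<le> p x"
proof -
  have "p (x + - x) \<le> p x + p (- x)" using assms unfolding sublinear_def by blast
  then show ?thesis using sublinear_zero[OF assms] by simp
qed

text \<open>The classical modification of a sublinear \<open>p\<close> in the direction
  \<open>a\<close>: it stays below \<open>p\<close>, is again sublinear, and is at most
  \<open>- p a\<close> at \<open>- a\<close>, so it is linear along \<open>a\<close>.\<close>

definition slope :: "('a::real_vector \<Rightarrow> real) \<Rightarrow> 'a \<Rightarrow> 'a \<Rightarrow> real"
  where "slope p a x = (INF t\<in>{0..}. p (x + t *\<^sub>R a) - t * p a)"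

lemma slope_le:
  assumes "sublinear p" "0 \<le> t"
  shows "slope p a x \<le> p (x + t *\<^sub>R a) - t * p a"
  unfolding slope_def
proof (rule cINF_lower)
  \<comment> \<open>Subadditivity at \<open>(x + t *\<^sub>R a) + (- x)\<close> gives the lower
    bound \<open>- p (- x)\<close>, so the infimum in \<open>slope\<close> is a genuine one.\<close>
  show "bdd_below ((\<lambda>t. p (x + t *\<^sub>R a) - t * p a) ` {0..})"
  proof (rule bdd_belowI2)
    fix s :: real assume "s \<in> {0..}"
    then have s: "p (s *\<^sub>R a) = s * p a" using assms(1) by (simp add: sublinear_def)
    have "p ((x + s *\<^sub>R a) + - x) \<le> p (x + s *\<^sub>R a) + p (- x)"
      using assms(1) unfolding sublinear_def by blast
    then show "- p (- x) \<le> p (x + s *\<^sub>R a) - s * p a" using s by simp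
  qed
qed (use assms in simp)

lemma slope_greatest:
  "(\<And>t. 0 \<le> t \<Longrightarrow> z \<le> p (x + t *\<^sub>R a) - t * p a) \<Longrightarrow> z \<le> slope p a x"
  unfolding slope_def by (rule cINF_greatest) auto

text \<open>Near-optimal parameters \<open>s\<close> and \<open>t\<close> for two points combine to
  \<open>s + t\<close> for their sum. Scaling by \<open>c\<close> replaces \<open>t\<close> by
  \<open>t / c\<close>; this yields one inequality, and the same with \<open>inverse c\<close>
  yields the other.\<close>

lemma sublinear_slope:
  assumes p: "sublinear p"
  shows "sublinear (slope p a)"
proof -
  have add: "slope p a (x + y) \<le> slope p a x + slope p a y" for x y
  proof -
    have "slope p a (x + y) - (p (x + s *\<^sub>R a) - s * p a) \<le> slope p a y" if s: "0 \<le> s" for s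
    proof (rule slope_greatest)
      fix t :: real assume t: "0 \<le> t"
      have "slope p a (x + y) \<le> p (x + y + (s + t) *\<^sub>R a) - (s + t) * p a"
        using s t by (intro slope_le p) auto
      also have "x + y + (s + t) *\<^sub>R a = (x + s *\<^sub>R a) + (y + t *\<^sub>R a)"
        by (simp add: algebra_simps)
      also have "p \<dots> \<le> p (x + s *\<^sub>R a) + p (y + t *\<^sub>R a)"
        using p unfolding sublinear_def by blast
      finally show "slope p a (x + y) - (p (x + s *\<^sub>R a) - s * p a) \<le> p (y + t *\<^sub>R a) - t * p a"
        by (simp add: algebra_simps)
    qed
    then have "slope p a (x + y) - slope p a y \<le> slope p a x"
      by (intro slope_greatest) (simp add: algebra_simps)
    then show ?thesis by simp
  qed
  have le: "c * slope p a x \<le> slope p a (c *\<^sub>R x)" if c: "0 < c" for c x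
  proof (rule slope_greatest)
    fix t :: real assume t: "0 \<le> t"
    have "slope p a x \<le> p (x + (t / c) *\<^sub>R a) - (t / c) * p a"
      using t c by (intro slope_le p) auto
    then have "c * slope p a x \<le> c * p (x + (t / c) *\<^sub>R a) - t * p a"
      using c by (simp add: field_simps)
    also have "c * p (x + (t / c) *\<^sub>R a) = p (c *\<^sub>R (x + (t / c) *\<^sub>R a))"
      using p c by (simp add: sublinear_def)
    also have "c *\<^sub>R (x + (t / c) *\<^sub>R a) = c *\<^sub>R x + t *\<^sub>R a"
      using c by (simp add: scaleR_right_distrib)
    finally show "c * slope p a x \<le> p (c *\<^sub>R x + t *\<^sub>R a) - t * p a" .
  qed
  have "slope p a (c *\<^sub>R x) = c * slope p a x" if c: "0 < c" for c x
  proof (rule antisym)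
    have "inverse c * slope p a (c *\<^sub>R x) \<le> slope p a (inverse c *\<^sub>R c *\<^sub>R x)"
      using c by (intro le) auto
    then show "slope p a (c *\<^sub>R x) \<le> c * slope p a x" using c by (simp add: field_simps)
  qed (use le c in auto)
  moreover have "slope p a 0 = 0"
  proof (rule antisym)
    show "slope p a 0 \<le> 0" using slope_le[OF p, of 0 a 0] sublinear_zero[OF p] by simp
    show "0 \<le> slope p a 0"
      using p by (intro slope_greatest) (simp add: sublinear_def)
  qed
  ultimately have "slope p a (c *\<^sub>R x) = c * slope p a x" if "0 \<le> c" for c x
    using that by (cases "c = 0") auto
  with add show ?thesis unfolding sublinear_def by blast
qed

text \<open>A minimal sublinear functional is linear, since it agrees with each of its slopes.\<close>

theorem sublinear_dominates_linear:
  fixes p :: "'a::real_vector \<Rightarrow> real"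
  assumes p: "sublinear p"
  obtains \<phi> where "linear \<phi>" "\<And>x. \<phi> x \<le> p x"
proof -
  define A where "A = {q. sublinear q \<and> q \<le> p}"
  \<comment> \<open>The pointwise order is reversed, so that a maximal element in Zorn's lemma is a
    minimal sublinear functional.\<close>
  define r where "r = {(q, q'). q \<in> A \<and> q' \<in> A \<and> q' \<le> q}"
  have Field: "Field r = A" by (auto simp: r_def Field_def)
  have po: "Partial_order r"
    unfolding partial_order_on_def preorder_on_def Field
    by (auto simp: r_def refl_on_def trans_def antisym_def)
  have "\<exists>u\<in>A. \<forall>q\<in>C. (q, u) \<in> r" if C: "C \<in> Chains r" for C
  proof (cases "C = {}")
    case True
    then show ?thesis using p by (auto simp: A_def)
  next
    case False
    have CA: "q \<in> A" if "q \<in> C" for q using C that by (auto simp: Chains_def r_def)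
    define u where "u x = (INF q\<in>C. q x)" for x
    have ul: "u x \<le> q x" if "q \<in> C" for q x unfolding u_def
    proof (rule cINF_lower[OF _ that])
      show "bdd_below ((\<lambda>q. q x) ` C)"
      proof (rule bdd_belowI2)
        fix q assume "q \<in> C"
        then have q: "sublinear q" "q \<le> p" using CA by (auto simp: A_def)
        then show "- p (- x) \<le> q x"
          using sublinear_ge_uminus[OF q(1), of x] by (auto simp: le_fun_def intro: order_trans[rotated])
      qed
    qed
    have ug: "z \<le> u x" if "\<And>q. q \<in> C \<Longrightarrow> z \<le> q x" for z x
      unfolding u_def using False that by (rule cINF_greatest)
    have add: "u (x + y) \<le> u x + u y" for x y
    proof -
      have "u (x + y) - q x \<le> u y" if q: "q \<in> C" for q
      proof (rule ug)
        fix q' assume q': "q' \<in> C"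
        \<comment> \<open>Two members of the chain are comparable, and subadditivity of the smaller
          one bounds \<open>u (x + y)\<close> by \<open>q x + q' y\<close>.\<close>
        have tot: "q \<le> q' \<or> q' \<le> q" using C q q' by (auto simp: Chains_def r_def)
        have "q (x + y) \<le> q x + q y" "q' (x + y) \<le> q' x + q' y"
          using CA q q' by (auto simp: A_def sublinear_def)
        then have "u (x + y) \<le> q x + q' y"
          using tot ul[OF q, of "x + y"] ul[OF q', of "x + y"]
          unfolding le_fun_def by (smt (verit))
        then show "u (x + y) - q x \<le> q' y" by simp
      qed
      then have "u (x + y) - u y \<le> u x" by (intro ug) (simp add: algebra_simps)
      then show ?thesis by simp
    qed
    have le: "c * u x \<le> u (c *\<^sub>R x)" if c: "0 \<le> c" for c x
    proof (rule ug)
      fix q assume q: "q \<in> C"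
      then have "q (c *\<^sub>R x) = c * q x" using CA c by (auto simp: A_def sublinear_def)
      then show "c * u x \<le> q (c *\<^sub>R x)" using ul[OF q] c by (simp add: mult_left_mono)
    qed
    have "u (c *\<^sub>R x) = c * u x" if c: "0 \<le> c" for c x
    proof (cases "c = 0")
      case True
      obtain q where q: "q \<in> C" using False by blast
      then have "q 0 = 0" using CA sublinear_zero by (auto simp: A_def)
      then have "u 0 = 0" using add[of 0 0] ul[OF q, of 0] by simp
      then show ?thesis using True by simp
    next
      case False
      have "inverse c * u (c *\<^sub>R x) \<le> u (inverse c *\<^sub>R c *\<^sub>R x)"
        using c by (intro le) auto
      then have "u (c *\<^sub>R x) \<le> c * u x" using c False by (simp add: field_simps)
      then show ?thesis using le[OF c] by (meson antisym)
    qed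
    with add have "sublinear u" unfolding sublinear_def by blast
    moreover have "u \<le> p"
    proof (rule le_funI)
      fix x
      obtain q where q: "q \<in> C" using False by blast
      then have "q x \<le> p x" using CA by (auto simp: A_def le_fun_def)
      with ul[OF q, of x] show "u x \<le> p x" by simp
    qed
    ultimately have "u \<in> A" by (simp add: A_def)
    then show ?thesis using CA ul by (auto simp: r_def le_fun_def)
  qed
  then obtain \<phi> where \<phi>: "\<phi> \<in> A" and min: "\<And>q. q \<in> A \<Longrightarrow> q \<le> \<phi> \<Longrightarrow> q = \<phi>"
    using Zorns_po_lemma[OF po] unfolding Field by (auto simp: r_def)
  then have sub: "sublinear \<phi>" and le: "\<phi> \<le> p" by (auto simp: A_def)
  have slope: "slope \<phi> a = \<phi>" for a
  proof (rule min)
    show *: "slope \<phi> a \<le> \<phi>"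
      using slope_le[OF sub, of 0 a] by (simp add: le_fun_def)
    then show "slope \<phi> a \<in> A" using sublinear_slope[OF sub] le by (auto simp: A_def)
  qed
  have add: "\<phi> (x + y) = \<phi> x + \<phi> y" for x y
  proof (rule antisym)
    show "\<phi> (x + y) \<le> \<phi> x + \<phi> y" using sub by (auto simp: sublinear_def)
    show "\<phi> x + \<phi> y \<le> \<phi> (x + y)"
      using slope_le[OF sub, of 1 y x] by (simp add: slope)
  qed
  have neg: "\<phi> (- x) = - \<phi> x" for x
    using add[of x "- x"] sublinear_zero[OF sub] by simp
  have "\<phi> (c *\<^sub>R x) = c * \<phi> x" for c x
  proof (cases "0 \<le> c")
    case True
    then show ?thesis using sub by (auto simp: sublinear_def)
  next
    case False
    then have "\<phi> ((- c) *\<^sub>R x) = (- c) * \<phi> x"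
      using sub unfolding sublinear_def by (metis linear neg_0_le_iff_le)
    then show ?thesis by (simp add: neg)
  qed
  with add have "linear \<phi>" by (intro linearI) auto
  with le that show ?thesis by (auto simp: le_fun_def)
qed

text \<open>A linear functional below \<open>slope norm e\<close> lies below the norm and is at most
  \<open>- norm e\<close> at \<open>- e\<close>, which forces it to norm \<open>e\<close>.\<close>

corollary norming_functional:
  fixes e :: "'a::real_normed_vector"
  obtains \<phi> where "linear \<phi>" "\<And>x. \<bar>\<phi> x\<bar> \<le> norm x" "\<phi> e = norm e"
proof -
  have norm: "sublinear (norm :: 'a \<Rightarrow> real)"
    by (auto simp: sublinear_def norm_triangle_ineq)
  obtain \<phi> where \<phi>: "linear \<phi>" "\<And>x. \<phi> x \<le> slope norm e x"
    using sublinear_dominates_linear[OF sublinear_slope[OF norm]] by blast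
  have le: "\<phi> x \<le> norm x" for x
    using \<phi>(2)[of x] slope_le[OF norm, of 0 e x] by simp
  have "\<bar>\<phi> x\<bar> \<le> norm x" for x
    using le[of x] le[of "- x"] linear_neg[OF \<phi>(1), of x] by auto
  moreover have "\<phi> (- e) \<le> - norm e"
    using \<phi>(2)[of "- e"] slope_le[OF norm, of 1 e "- e"] by simp
  then have "\<phi> e = norm e"
    using le[of e] linear_neg[OF \<phi>(1), of e] by simp
  ultimately show ?thesis using that \<phi>(1) by blast
qed

section \<open>Rosenthal's lemma and the theorem of Bessaga and Pelczynski\<close>

text \<open>
  If every piece of a partition of \<open>A\<close> into infinitely many infinite pieces
  has a bad row, then the set of these rows meets each piece once, so that all its row sums
  have dropped by \<open>\<eta>\<close>.
\<close>

lemma rosenthal: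
  fixes a :: "nat \<Rightarrow> nat \<Rightarrow> real"
  assumes nonneg: "\<And>i j. 0 \<le> a i j"
    and "infinite A" and "0 < \<eta>"
    and "\<And>i F. i \<in> A \<Longrightarrow> finite F \<Longrightarrow> F \<subseteq> A - {i} \<Longrightarrow> sum (a i) F \<le> of_nat k * \<eta>"
  obtains M where "M \<subseteq> A" "infinite M"
    "\<And>i F. i \<in> M \<Longrightarrow> finite F \<Longrightarrow> F \<subseteq> M - {i} \<Longrightarrow> sum (a i) F \<le> \<eta>"
proof -
  have "\<exists>M\<subseteq>A. infinite M \<and> (\<forall>i\<in>M. \<forall>F. finite F \<longrightarrow> F \<subseteq> M - {i} \<longrightarrow> sum (a i) F \<le> \<eta>)"
    using assms(2,4)
  proof (induction k arbitrary: A)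
    case 0
    have "sum (a i) F \<le> \<eta>" if "i \<in> A" "finite F" "F \<subseteq> A - {i}" for i F
      using "0.prems"(2)[OF that] \<open>0 < \<eta>\<close> by simp
    then show ?case using 0 by blast
  next
    case (Suc k)
    obtain g :: "nat \<Rightarrow> nat" where g: "inj g" "range g \<subseteq> A"
      using iffD1[OF infinite_iff_countable_subset Suc.prems(1)] by blast
    define P where "P p = range (\<lambda>n. g (prod_encode (p, n)))" for p
    have PA: "P p \<subseteq> A" for p using g by (auto simp: P_def)
    have Pinf: "infinite (P p)" for p unfolding P_def
      by (rule range_inj_infinite) (simp add: inj_def inj_eq[OF g(1)] prod_encode_eq)
    have Pdisj: "p = p'" if "x \<in> P p" "x \<in> P p'" for p p' x
      using that by (auto simp: P_def inj_eq[OF g(1)] prod_encode_eq)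
    show ?case
    proof (cases "\<exists>p. \<forall>i\<in>P p. \<forall>F. finite F \<longrightarrow> F \<subseteq> P p - {i} \<longrightarrow> sum (a i) F \<le> \<eta>")
      case True
      then obtain p where "\<forall>i\<in>P p. \<forall>F. finite F \<longrightarrow> F \<subseteq> P p - {i} \<longrightarrow> sum (a i) F \<le> \<eta>" ..
      then show ?thesis using PA[of p] Pinf[of p] by (intro exI[of _ "P p"]) simp
    next
      case False
      then have "\<exists>i F. i \<in> P p \<and> finite F \<and> F \<subseteq> P p - {i} \<and> \<eta> < sum (a i) F" for p
        unfolding not_le[symmetric] by (simp add: Bex_def)
      then obtain i F where i: "\<And>p. i p \<in> P p" and F: "\<And>p. finite (F p)"
        "\<And>p. F p \<subseteq> P p - {i p}" "\<And>p. \<eta> < sum (a (i p)) (F p)"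
        by metis
      have "inj i" using i Pdisj by (metis injI)
      then have inf: "infinite (range i)" by (rule range_inj_infinite)
      have "sum (a q) G \<le> of_nat k * \<eta>" if q: "q \<in> range i" and G: "finite G" "G \<subseteq> range i - {q}" for q G
      proof -
        obtain p where p: "q = i p" using q by auto
        \<comment> \<open>The only chosen row in the piece \<open>P p\<close> is \<open>i p\<close>,
          which \<open>G\<close> omits. So the excess over \<open>F p\<close> can be split off, and
          \<open>Suc k\<close> drops to \<open>k\<close>.\<close>
        have disj: "G \<inter> F p = {}" using G(2) F(2)[of p] i Pdisj p by blast
        have "sum (a q) (G \<union> F p) \<le> of_nat (Suc k) * \<eta>"
        proof (rule Suc.prems(2))
          show "G \<union> F p \<subseteq> A - {q}" using G(2) F(2)[of p] PA i p by blast
        qed (use i PA F(1) G p in auto)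
        moreover have "sum (a q) (G \<union> F p) = sum (a q) G + sum (a q) (F p)"
          using G F(1) disj by (intro sum.union_disjoint) auto
        ultimately show ?thesis using F(3)[of p] p by (simp add: algebra_simps)
      qed
      from Suc.IH[OF inf this] obtain M where "M \<subseteq> range i" and M: "infinite M"
        "\<forall>i\<in>M. \<forall>F. finite F \<longrightarrow> F \<subseteq> M - {i} \<longrightarrow> sum (a i) F \<le> \<eta>"
        by auto
      moreover have "range i \<subseteq> A" using i PA by blast
      ultimately have "M \<subseteq> A" by simp
      with M show ?thesis by (intro exI[of _ M]) simp
    qed
  qed
  then show ?thesis using that by auto
qed

lemma isomorphic_embeddingI:
  assumes S: "bounded_linear S" and c: "0 < c" "\<And>x. c * norm x \<le> norm (S x)"
  shows "isomorphic_embedding S"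
proof -
  interpret bounded_linear S by fact
  have "inj S"
  proof (rule injI)
    fix x y assume "S x = S y"
    then have "c * norm (x - y) \<le> 0" using c(2)[of "x - y"] by (simp add: diff)
    then show "x = y" using c(1) by (simp add: mult_le_0_iff)
  qed
  moreover have "\<forall>y\<in>range S. norm (inv S y) \<le> inverse c * norm y"
    using c by (auto simp: inv_f_f[OF \<open>inj S\<close>] field_simps)
  ultimately show ?thesis using S unfolding isomorphic_embedding_def by blast
qed

text \<open>Weakly unconditionally Cauchy series, in the equivalent form of bounded finite sums with
  bounded multipliers, which avoids the dual space.\<close>

definition wuc :: "(nat \<Rightarrow> 'e::real_normed_vector) \<Rightarrow> bool"
  where "wuc e \<longleftrightarrow> (\<exists>B. \<forall>I a. finite I \<longrightarrow> (\<forall>i\<in>I. \<bar>a i\<bar> \<le> 1) \<longrightarrow> norm (\<Sum>i\<in>I. a i *\<^sub>R e i) \<le> B)"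

text \<open>The homogeneous form of the bound. Passing to \<open>max B 1\<close> makes the constant
  positive, so that it can serve as a divisor.\<close>

lemma wucE:
  assumes "wuc e"
  obtains B where "0 < B"
    "\<And>I a c. finite I \<Longrightarrow> 0 \<le> c \<Longrightarrow> (\<And>i. i \<in> I \<Longrightarrow> \<bar>a i\<bar> \<le> c) \<Longrightarrow> norm (\<Sum>i\<in>I. a i *\<^sub>R e i) \<le> B * c"
proof -
  obtain B where B: "\<And>I a. finite I \<Longrightarrow> (\<And>i. i \<in> I \<Longrightarrow> \<bar>a i\<bar> \<le> 1) \<Longrightarrow> norm (\<Sum>i\<in>I. a i *\<^sub>R e i) \<le> B"
    using assms unfolding wuc_def by meson
  have "norm (\<Sum>i\<in>I. a i *\<^sub>R e i) \<le> max B 1 * c"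
    if I: "finite I" and c: "0 \<le> c" and a: "\<And>i. i \<in> I \<Longrightarrow> \<bar>a i\<bar> \<le> c" for I a c
  proof (cases "c = 0")
    case True
    then have "(\<Sum>i\<in>I. a i *\<^sub>R e i) = 0" using a by (intro sum.neutral) auto
    then show ?thesis using True by simp
  next
    case False
    have "(\<Sum>i\<in>I. a i *\<^sub>R e i) = c *\<^sub>R (\<Sum>i\<in>I. (a i / c) *\<^sub>R e i)"
      using False by (simp add: scaleR_sum_right)
    moreover have "norm (\<Sum>i\<in>I. (a i / c) *\<^sub>R e i) \<le> B"
      using I a c False by (intro B) auto
    then have "norm (\<Sum>i\<in>I. (a i / c) *\<^sub>R e i) \<le> max B 1" by simp
    ultimately show ?thesis using c by (simp add: mult.commute mult_left_mono del: max.bounded_iff)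
  qed
  then show ?thesis using that[of "max B 1"] by simp
qed

text \<open>Functionals norming the \<open>e i\<close> give a matrix with bounded row sums.
  Rosenthal's lemma selects indices whose off-diagonal row sums are at most
  \<open>\<delta> / 2\<close>, while the diagonal is at least \<open>\<delta>\<close>; along these
  indices the series spans a copy of \<open>c0\<close>.\<close>

theorem bessaga_pelczynski:
  fixes e :: "nat \<Rightarrow> 'e::banach"
  assumes wuc: "wuc e" and \<delta>: "0 < \<delta>" "\<And>i. \<delta> \<le> norm (e i)"
  shows "contains_c0 TYPE('e)"
proof -
  obtain B where B: "0 < B"
    "\<And>I a c. finite I \<Longrightarrow> 0 \<le> c \<Longrightarrow> (\<And>i. i \<in> I \<Longrightarrow> \<bar>a i\<bar> \<le> c) \<Longrightarrow> norm (\<Sum>i\<in>I. a i *\<^sub>R e i) \<le> B * c"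
    using wucE[OF wuc] by blast
  have "\<forall>i. \<exists>\<phi>. linear \<phi> \<and> (\<forall>x. \<bar>\<phi> x\<bar> \<le> norm x) \<and> \<phi> (e i) = norm (e i)"
    by (metis norming_functional)
  then obtain \<phi> where \<phi>: "\<And>i. linear (\<phi> i)" "\<And>i x. \<bar>\<phi> i x\<bar> \<le> norm x" "\<And>i. \<phi> i (e i) = norm (e i)"
    by metis
  have row: "(\<Sum>j\<in>F. \<bar>\<phi> i (e j)\<bar>) \<le> B" if "finite F" for i F
  proof -
    \<comment> \<open>The signs of the entries, used as multipliers, turn the absolute row sum into
      a single value of \<open>\<phi> i\<close>.\<close>
    have "(\<Sum>j\<in>F. \<bar>\<phi> i (e j)\<bar>) = \<phi> i (\<Sum>j\<in>F. sgn (\<phi> i (e j)) *\<^sub>R e j)"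
      by (simp add: linear_sum[OF \<phi>(1)] linear_scale[OF \<phi>(1)] abs_sgn mult.commute)
    also have "\<dots> \<le> norm (\<Sum>j\<in>F. sgn (\<phi> i (e j)) *\<^sub>R e j)"
      using \<phi>(2) by (meson abs_le_D1)
    also have "\<dots> \<le> B * 1" using that by (intro B(2)) (auto simp: sgn_real_def)
    finally show ?thesis by simp
  qed
  obtain k where k: "B \<le> of_nat k * (\<delta> / 2)"
    using reals_Archimedean3[of "\<delta> / 2"] \<delta>(1) by (meson half_gt_zero less_imp_le)
  obtain M where M: "infinite M"
    "\<And>i F. i \<in> M \<Longrightarrow> finite F \<Longrightarrow> F \<subseteq> M - {i} \<Longrightarrow> (\<Sum>j\<in>F. \<bar>\<phi> i (e j)\<bar>) \<le> \<delta> / 2"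
  proof (rule rosenthal[where a = "\<lambda>i j. \<bar>\<phi> i (e j)\<bar>" and A = UNIV and \<eta> = "\<delta> / 2" and k = k])
    show "(\<Sum>j\<in>F. \<bar>\<phi> i (e j)\<bar>) \<le> of_nat k * (\<delta> / 2)" if "finite F" for i F
      using row[OF that] k by (rule order_trans)
    fix M :: "nat set"
    assume "infinite M"
      "\<And>i F. i \<in> M \<Longrightarrow> finite F \<Longrightarrow> F \<subseteq> M - {i} \<Longrightarrow> (\<Sum>j\<in>F. \<bar>\<phi> i (e j)\<bar>) \<le> \<delta> / 2"
    then show ?thesis by (rule that)
  qed (simp_all add: \<delta>(1))
  obtain r :: "nat \<Rightarrow> nat" where r: "inj r" "range r \<subseteq> M"
    using iffD1[OF infinite_iff_countable_subset M(1)] by blast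
  define c where "c x j = apply_bcontfun (Rep_c0 x) j" for x j
  define P where "P x n = (\<Sum>j<n. c x j *\<^sub>R e (r j))" for x n
  define S where "S x = (\<Sum>j. c x j *\<^sub>R e (r j))" for x
  have c_add: "c (x + y) j = c x j + c y j" and c_scale: "c (t *\<^sub>R x) j = t * c x j" for x y t j
    by (simp_all add: c_def plus_c0.rep_eq scaleR_c0.rep_eq)
  have c_le: "\<bar>c x j\<bar> \<le> norm x" for x j
    using norm_bounded[of "Rep_c0 x" j] by (simp add: c_def norm_c0.rep_eq)
  have c_lim: "c x \<longlonglongrightarrow> 0" for x using Rep_c0[of x] by (simp add: c_def[abs_def])
  have block: "norm (\<Sum>j\<in>I. a j *\<^sub>R e (r j)) \<le> B * t"
    if "finite I" "0 \<le> t" "\<And>j. j \<in> I \<Longrightarrow> \<bar>a j\<bar> \<le> t" for I a t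
  proof -
    have inj: "inj_on r I" using r(1) by (auto simp: inj_on_def)
    have "(\<Sum>j\<in>I. a j *\<^sub>R e (r j)) = (\<Sum>i\<in>r ` I. a (inv r i) *\<^sub>R e i)"
      by (simp add: sum.reindex[OF inj] r(1))
    also have "norm \<dots> \<le> B * t" using that r(1) by (intro B(2)) auto
    finally show ?thesis .
  qed
  have summ: "summable (\<lambda>j. c x j *\<^sub>R e (r j))" for x
    unfolding summable_Cauchy
  proof (intro allI impI)
    fix \<epsilon> :: real assume \<epsilon>: "0 < \<epsilon>"
    then have "0 < \<epsilon> / (2 * B)" using B(1) by simp
    then obtain N where N: "\<And>n. n \<ge> N \<Longrightarrow> \<bar>c x n\<bar> < \<epsilon> / (2 * B)"
      using LIMSEQ_D[OF c_lim[of x]] by (metis diff_zero real_norm_def)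
    have "norm (sum (\<lambda>j. c x j *\<^sub>R e (r j)) {m..<n}) < \<epsilon>" if "m \<ge> N" for m n
    proof -
      have "norm (sum (\<lambda>j. c x j *\<^sub>R e (r j)) {m..<n}) \<le> B * (\<epsilon> / (2 * B))"
      proof (rule block)
        fix j assume "j \<in> {m..<n}"
        then show "\<bar>c x j\<bar> \<le> \<epsilon> / (2 * B)" using N[of j] that by simp
      qed (use \<epsilon> B(1) in auto)
      also have "\<dots> < \<epsilon>" using \<epsilon> B(1) by simp
      finally show ?thesis .
    qed
    then show "\<exists>N. \<forall>m\<ge>N. \<forall>n. norm (sum (\<lambda>j. c x j *\<^sub>R e (r j)) {m..<n}) < \<epsilon>" by blast
  qed
  have lim: "P x \<longlonglongrightarrow> S x" for x
    unfolding P_def S_def by (rule summable_LIMSEQ[OF summ])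
  have S: "bounded_linear S"
  proof (rule bounded_linear_intro)
    show "S (x + y) = S x + S y" for x y
      unfolding S_def by (simp add: c_add scaleR_left_distrib suminf_add[OF summ summ])
    show "S (t *\<^sub>R x) = t *\<^sub>R S x" for t x
      unfolding S_def by (simp add: c_scale suminf_scaleR_right[OF summ] flip: scaleR_scaleR)
    show "norm (S x) \<le> norm x * B" for x
    proof (rule LIMSEQ_le_const2)
      show "(\<lambda>n. norm (P x n)) \<longlonglongrightarrow> norm (S x)" by (intro tendsto_norm lim)
      show "\<exists>N. \<forall>n\<ge>N. norm (P x n) \<le> norm x * B"
        unfolding P_def using block[of "{..<_}" "norm x" "c x"] c_le by (auto simp: mult.commute)
    qed
  qed
  \<comment> \<open>The functional at \<open>r i\<close> reads off the coordinate \<open>i\<close>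
    with weight at least \<open>\<delta>\<close>; the other coordinates disturb it by at most
    \<open>norm x * (\<delta> / 2)\<close>.\<close>
  have coord: "\<bar>c x i\<bar> * \<delta> \<le> norm (S x) + norm x * (\<delta> / 2)" for x i
  proof -
    let ?\<phi> = "\<phi> (r i)"
    have "\<bar>c x i\<bar> * \<delta> - norm x * (\<delta> / 2) \<le> norm (P x n)" if n: "n > i" for n
    proof -
      have "?\<phi> (P x n) = (\<Sum>j<n. c x j * ?\<phi> (e (r j)))"
        unfolding P_def by (simp add: linear_sum[OF \<phi>(1)] linear_scale[OF \<phi>(1)])
      also have "\<dots> = c x i * norm (e (r i)) + (\<Sum>j\<in>{..<n} - {i}. c x j * ?\<phi> (e (r j)))"
        using n by (subst sum.remove[of _ i]) (auto simp: \<phi>(3))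
      finally have eq: "?\<phi> (P x n) = \<dots>" .
      have "\<bar>\<Sum>j\<in>{..<n} - {i}. c x j * ?\<phi> (e (r j))\<bar> \<le> (\<Sum>j\<in>{..<n} - {i}. norm x * \<bar>?\<phi> (e (r j))\<bar>)"
        by (rule order_trans[OF sum_abs])
          (auto intro!: sum_mono mult_right_mono c_le simp: abs_mult)
      also have "\<dots> = norm x * (\<Sum>j\<in>{..<n} - {i}. \<bar>?\<phi> (e (r j))\<bar>)" by (simp add: sum_distrib_left)
      also have "(\<Sum>j\<in>{..<n} - {i}. \<bar>?\<phi> (e (r j))\<bar>) = (\<Sum>q\<in>r ` ({..<n} - {i}). \<bar>?\<phi> (e q)\<bar>)"
        by (simp add: sum.reindex[OF inj_on_subset[OF r(1)]])
      also have "\<dots> \<le> \<delta> / 2"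
        using r by (intro M(2)) (auto dest: injD)
      finally have "\<bar>\<Sum>j\<in>{..<n} - {i}. c x j * ?\<phi> (e (r j))\<bar> \<le> norm x * (\<delta> / 2)"
        by (simp add: mult_left_mono)
      moreover have "\<bar>c x i\<bar> * \<delta> \<le> \<bar>c x i * norm (e (r i))\<bar>"
        by (simp add: abs_mult \<delta> mult_left_mono)
      moreover have "\<bar>?\<phi> (P x n)\<bar> \<le> norm (P x n)" by (rule \<phi>(2))
      ultimately show ?thesis using eq by linarith
    qed
    then have "\<bar>c x i\<bar> * \<delta> - norm x * (\<delta> / 2) \<le> norm (S x)"
      by (intro LIMSEQ_le_const[OF tendsto_norm[OF lim]]) (auto intro: exI[of _ "Suc i"])
    then show ?thesis by simp
  qed
  \<comment> \<open>In the supremum over all coordinates the error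
    \<open>norm x * (\<delta> / 2)\<close> is absorbed, which leaves the constant
    \<open>\<delta> / 2\<close>.\<close>
  have "(\<delta> / 2) * norm x \<le> norm (S x)" for x
  proof -
    have "norm (Rep_c0 x) \<le> (norm (S x) + norm x * (\<delta> / 2)) / \<delta>"
      using coord[of x] \<delta>(1) by (intro norm_bound) (simp add: c_def field_simps)
    then show ?thesis using \<delta>(1) by (simp add: norm_c0.rep_eq[symmetric] field_simps)
  qed
  with S \<delta>(1) have "isomorphic_embedding S"
    by (intro isomorphic_embeddingI[of S "\<delta> / 2"]) auto
  then show ?thesis unfolding contains_c0_def by blast
qed

section \<open>Consequences of the cotype inequality\<close>

definition has_cotype :: "'e::real_normed_vector itself \<Rightarrow> real \<Rightarrow> real \<Rightarrow> bool"
  where "has_cotype _ q C \<longleftrightarrow> 2 \<le> q \<and> 0 < C \<and>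
    (\<forall>(n::nat) (e :: nat \<Rightarrow> 'e).
      (\<Sum>i=1..n. norm (e i) powr q) powr (1 / q) \<le>
      C * sqrt (integral {0..1} (\<lambda>t. (norm (\<Sum>i=1..n. rademacher i t *\<^sub>R e i))\<^sup>2)))"

lemma nontrivial_cotype_iff: "nontrivial_cotype TYPE('e::real_normed_vector) \<longleftrightarrow> (\<exists>q C. has_cotype TYPE('e) q C)"
  by (simp add: nontrivial_cotype_def has_cotype_def)

text \<open>At every \<open>t\<close> the Rademacher sum has coefficients of modulus at most 1, so a
  uniform bound on such sums bounds the quadratic average.\<close>

lemma has_cotype_sum_le:
  fixes e :: "'i \<Rightarrow> 'e::real_normed_vector"
  assumes cotype: "has_cotype TYPE('e) q C" and I: "finite I" and R: "0 \<le> R"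
    and e: "\<And>s. (\<And>i. i \<in> I \<Longrightarrow> \<bar>s i\<bar> \<le> 1) \<Longrightarrow> norm (\<Sum>i\<in>I. s i *\<^sub>R e i) \<le> R"
  shows "(\<Sum>i\<in>I. norm (e i) powr q) \<le> (C * R) powr q"
proof -
  have q: "2 \<le> q" and C: "0 < C" and cot:
    "(\<Sum>i=1..n. norm (e i) powr q) powr (1 / q) \<le>
      C * sqrt (integral {0..1} (\<lambda>t. (norm (\<Sum>i=1..n. rademacher i t *\<^sub>R e i))\<^sup>2))"
    for n and e :: "nat \<Rightarrow> 'e"
    using cotype by (simp_all add: has_cotype_def)
  obtain h where h: "bij_betw h {1..card I} I"
    using I ex_bij_betw_nat_finite_1 by blast
  define n where "n = card I"
  have h: "bij_betw h {1..n} I" using h by (simp add: n_def)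
  have bound: "norm (\<Sum>i=1..n. rademacher i t *\<^sub>R e (h i)) \<le> R" for t
  proof -
    define g where "g = the_inv_into {1..n} h"
    have "(\<Sum>i=1..n. rademacher i t *\<^sub>R e (h i)) = (\<Sum>i=1..n. rademacher (g (h i)) t *\<^sub>R e (h i))"
      using h by (intro sum.cong) (auto simp: g_def the_inv_into_f_f bij_betw_def)
    also have "\<dots> = (\<Sum>i\<in>I. rademacher (g i) t *\<^sub>R e i)"
      by (rule sum.reindex_bij_betw[OF h])
    also have "norm \<dots> \<le> R" by (rule e) (auto simp: rademacher_def sgn_real_def)
    finally show ?thesis .
  qed
  let ?f = "\<lambda>t. (norm (\<Sum>i=1..n. rademacher i t *\<^sub>R e (h i)))\<^sup>2"
  have int: "integral {0..1} ?f \<le> R\<^sup>2"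
  proof (cases "?f integrable_on {0..1}")
    case True
    have "integral {0..1} ?f \<le> integral {0..1} (\<lambda>t::real. R\<^sup>2)"
      using True bound by (intro integral_le) (auto intro!: power_mono)
    then show ?thesis by simp
  next
    \<comment> \<open>The integral of a nonintegrable function is 0 by convention, so the bound is
      immediate in this case.\<close>
    case False
    then show ?thesis by (simp add: not_integrable_integral)
  qed
  have "(\<Sum>i\<in>I. norm (e i) powr q) = (\<Sum>i=1..n. norm (e (h i)) powr q)"
    by (rule sum.reindex_bij_betw[OF h, symmetric])
  also have "\<dots> = ((\<Sum>i=1..n. norm (e (h i)) powr q) powr (1 / q)) powr q"
    using q by (simp add: powr_powr sum_nonneg)
  also have "\<dots> \<le> (C * R) powr q"
  proof (rule powr_mono2)
    have "(\<Sum>i=1..n. norm (e (h i)) powr q) powr (1 / q) \<le> C * sqrt (integral {0..1} ?f)"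
by (rule cot)
    also have "\<dots> \<le> C * R"
      using C R int by (intro mult_left_mono) (auto intro: real_le_lsqrt)
    finally show "(\<Sum>i=1..n. norm (e (h i)) powr q) powr (1 / q) \<le> C * R" .
  qed (use q in auto)
  finally show ?thesis .
qed

section \<open>Cardinals and compact spaces\<close>

lemma finite_card_of_less_infinite: "finite A \<Longrightarrow> infinite B \<Longrightarrow> |A| <o |B|"
  by (metis card_of_Well_order card_of_ordLeq_infinite not_ordLeq_iff_ordLess)

lemma card_of_le_finite_fibres:
  assumes "infinite A" and fin: "\<And>b. b \<in> f ` A \<Longrightarrow> finite {a \<in> A. f a = b}"
  shows "|A| \<le>o |f ` A|"
proof -
  have eq: "(\<Union>b\<in>f ` A. {a \<in> A. f a = b}) = A" by auto
  have inf: "infinite (f ` A)"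
  proof
    assume "finite (f ` A)"
    then have "finite (\<Union>b\<in>f ` A. {a \<in> A. f a = b})" using fin by blast
    then show False using \<open>infinite A\<close> eq by simp
  qed
  have "|\<Union>b\<in>f ` A. {a \<in> A. f a = b}| \<le>o |f ` A|"
  proof (rule card_of_UNION_ordLeq_infinite[OF inf])
    show "|f ` A| \<le>o |f ` A|" by (rule card_of_mono1) simp
    show "\<forall>b\<in>f ` A. |{a \<in> A. f a = b}| \<le>o |f ` A|"
      using fin inf by (blast intro: ordLess_imp_ordLeq finite_card_of_less_infinite)
  qed
  then show ?thesis unfolding eq .
qed

text \<open>A finite union of sets smaller than an infinite set is again smaller, for regular and
  singular cardinals alike; so one of finitely many classes keeps the full cardinality.\<close>

lemma infinite_pigeonhole_card_of:
  fixes g :: "'a \<Rightarrow> 'b"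
  assumes "finite J" "infinite D" "g ` D \<subseteq> J"
  obtains j where "j \<in> J" "|D| \<le>o |{d \<in> D. g d = j}|"
proof -
  have "|\<Union>j\<in>J. {d \<in> D. g d = j}| <o |D|" if less: "\<And>j. j \<in> J \<Longrightarrow> |{d \<in> D. g d = j}| <o |D|"
    using \<open>finite J\<close> less
  proof (induction J)
    case empty
    then show ?case using \<open>infinite D\<close> by (auto intro: finite_card_of_less_infinite)
  next
    case (insert j J)
    then show ?case
      unfolding UN_insert by (intro card_of_Un_ordLess_infinite[OF \<open>infinite D\<close>]) auto
  qed
  moreover have "(\<Union>j\<in>J. {d \<in> D. g d = j}) = D" using assms(3) by auto
  moreover have "\<not> |D| <o |D|" by (metis not_ordLess_ordIso card_of_refl)
  ultimately obtain j where "j \<in> J" "\<not> |{d \<in> D. g d = j}| <o |D|" by metis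
  then show ?thesis using that card_of_Well_order not_ordLess_iff_ordLeq by blast
qed

text \<open>Free sets of a set mapping; the condition \<open>x \<noteq> y\<close> allows a point to
  lie in its own image.\<close>

definition free_set :: "('a \<Rightarrow> 'a set) \<Rightarrow> 'a set \<Rightarrow> bool"
  where "free_set \<Gamma> H \<longleftrightarrow> (\<forall>x\<in>H. \<forall>y\<in>H. x \<noteq> y \<longrightarrow> x \<notin> \<Gamma> y)"

text \<open>
  If a maximal free set \<open>H\<close> is too small, then off \<open>H\<close> and its images every \<open>\<Gamma> x\<close> meets \<open>H\<close>, so
  removing \<open>H\<close> from the values of \<open>\<Gamma>\<close> lowers their cardinality.
\<close>

lemma free_set_of_full_card:
  assumes "infinite D" and "\<And>d. d \<in> D \<Longrightarrow> finite (\<Gamma> d) \<and> card (\<Gamma> d) \<le> n"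
  obtains D' where "D' \<subseteq> D" "|D| \<le>o |D'|" "free_set \<Gamma> D'"
proof -
  have "\<exists>D'\<subseteq>D. |D| \<le>o |D'| \<and> free_set \<Gamma> D'"
    using assms
  proof (induction n arbitrary: D \<Gamma>)
    case 0
    then have "\<Gamma> d = {}" if "d \<in> D" for d using that by fastforce
    then have "free_set \<Gamma> D" by (auto simp: free_set_def)
    then show ?case using card_of_refl ordIso_iff_ordLeq by blast
  next
    case (Suc n)
    let ?F = "{H. H \<subseteq> D \<and> free_set \<Gamma> H}"
    have "\<exists>H\<in>?F. \<forall>X\<in>?F. H \<subseteq> X \<longrightarrow> X = H"
    proof (rule subset_Zorn')
      fix \<C> assume \<C>: "subset.chain ?F \<C>"
      have "x \<notin> \<Gamma> y" if x: "X \<in> \<C>" "x \<in> X" and y: "Y \<in> \<C>" "y \<in> Y" and "x \<noteq> y" for x y X Y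
      proof -
        have "X \<subseteq> Y \<or> Y \<subseteq> X" using \<C> x(1) y(1) by (auto simp: subset_chain_def)
        moreover have "free_set \<Gamma> X" "free_set \<Gamma> Y" using \<C> x(1) y(1) by (auto simp: subset_chain_def)
        ultimately show ?thesis using that by (auto simp: free_set_def)
      qed
      then show "\<Union>\<C> \<in> ?F" using \<C> by (auto simp: free_set_def subset_chain_def)
    qed
    then obtain H where H: "H \<subseteq> D" "free_set \<Gamma> H"
      and max: "\<And>X. X \<subseteq> D \<Longrightarrow> free_set \<Gamma> X \<Longrightarrow> H \<subseteq> X \<Longrightarrow> X = H"
      by auto
    show ?case
    proof (cases "|D| \<le>o |H|")
      case True
      then show ?thesis using H by blast
    next
      case False
      then have less: "|H| <o |D|" using card_of_Well_order not_ordLeq_iff_ordLess by blast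
      let ?U = "\<Union>h\<in>H. \<Gamma> h"
      have "|?U| <o |D|"
      proof (cases "finite H")
        case True
        then have "finite ?U" using H(1) Suc.prems(2) by blast
        then show ?thesis using Suc.prems(1) by (rule finite_card_of_less_infinite)
      next
        case False
        have "|?U| \<le>o |H|"
        proof (rule card_of_UNION_ordLeq_infinite[OF False])
          show "|H| \<le>o |H|" by (rule card_of_mono1) simp
          show "\<forall>h\<in>H. |\<Gamma> h| \<le>o |H|"
            using H(1) Suc.prems(2) False by (auto intro!: ordLess_imp_ordLeq finite_card_of_less_infinite)
        qed
        then show ?thesis using less by (rule ordLeq_ordLess_trans)
      qed
      then have small: "|H \<union> ?U| <o |D|"
        using card_of_Un_ordLess_infinite[OF Suc.prems(1) less] by blast
      define D1 where "D1 = D - (H \<union> ?U)"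
      have big: "|D| \<le>o |D1|"
      proof (rule ccontr)
        assume "\<not> |D| \<le>o |D1|"
        then have "|D1| <o |D|" using card_of_Well_order not_ordLeq_iff_ordLess by blast
        then have "|(H \<union> ?U) \<union> D1| <o |D|"
          using card_of_Un_ordLess_infinite[OF Suc.prems(1) small] by blast
        moreover have "|D| \<le>o |(H \<union> ?U) \<union> D1|" by (rule card_of_mono1) (auto simp: D1_def)
        ultimately show False using not_ordLess_ordLeq by blast
      qed
      have inf: "infinite D1" using big Suc.prems(1) by (metis card_of_ordLeq_infinite)
      have red: "finite (\<Gamma> d - H) \<and> card (\<Gamma> d - H) \<le> n" if d: "d \<in> D1" for d
      proof -
        have dD: "d \<in> D" "d \<notin> H" "d \<notin> ?U" using d by (auto simp: D1_def)
        have "\<not> free_set \<Gamma> (insert d H)" using max[of "insert d H"] H(1) dD by auto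
        then obtain h where h: "h \<in> H" "h \<in> \<Gamma> d" using H(2) dD by (auto simp: free_set_def)
        then have "\<Gamma> d - H \<subset> \<Gamma> d" by blast
        then have "card (\<Gamma> d - H) < card (\<Gamma> d)" using Suc.prems(2)[OF dD(1)] by (meson psubset_card_mono)
        then show ?thesis using Suc.prems(2)[OF dD(1)] by auto
      qed
      have "\<exists>D'\<subseteq>D1. |D1| \<le>o |D'| \<and> free_set (\<lambda>d. \<Gamma> d - H) D'"
        by (rule Suc.IH[of D1 "\<lambda>d. \<Gamma> d - H", OF inf red])
      then obtain D' where D': "D' \<subseteq> D1" "|D1| \<le>o |D'|"
        "free_set (\<lambda>d. \<Gamma> d - H) D'" by auto
      \<comment> \<open>\<open>D'\<close> avoids \<open>H\<close>, so deleting \<open>H\<close> from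
        the values of \<open>\<Gamma>\<close> does not affect freeness on \<open>D'\<close>.\<close>
      have "free_set \<Gamma> D'" using D'(1,3) by (auto simp: free_set_def D1_def)
      moreover have "D' \<subseteq> D" using D'(1) by (auto simp: D1_def)
      moreover have "|D| \<le>o |D'|" using big D'(2) by (rule ordLeq_transitive)
      ultimately show ?thesis by (intro exI[of _ D'] conjI)
    qed
  qed
  then obtain D' where "D' \<subseteq> D" "|D| \<le>o |D'|" "free_set \<Gamma> D'" by auto
  then show ?thesis by (rule that)
qed

section \<open>Cantor-Bendixson derivatives are closed and decreasing\<close>

lemma closed_acc_points:
  fixes S :: "'a::t1_space set"
  assumes "closed S"
  shows "closed (acc_points S)"
proof -
  have "x islimpt S" if x: "x islimpt {x. x islimpt S}" for x
  proof (rule islimptI)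
    fix U assume U: "x \<in> U" "open U"
    then obtain y where "y islimpt S" "y \<in> U" using islimptE[OF x] by auto
    \<comment> \<open>In a T1 space a neighbourhood of a limit point meets \<open>S\<close> in
      infinitely many points, hence in one other than \<open>x\<close>.\<close>
    then have "infinite (U \<inter> S)" using U(2) by (auto simp: islimpt_eq_acc_point)
    then have "\<not> U \<inter> S \<subseteq> {x}" using finite_subset by blast
    then show "\<exists>y\<in>S. y \<in> U \<and> y \<noteq> x" by blast
  qed
  then have "closed {x. x islimpt S}" by (simp add: closed_limpt)
  moreover have "acc_points S = S \<inter> {x. x islimpt S}" by (auto simp: acc_points_def)
  ultimately show ?thesis using closed_Int[OF assms] by simp
qed

lemma closed_cb_deriv:
  fixes X :: "'a::t1_space set"
  assumes "closed X"
  shows "closed (cb_deriv X \<alpha>)"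
proof (induction \<alpha> rule: less_induct)
  case (less \<alpha>)
  show ?case
  proof (cases "\<forall>\<beta>. \<alpha> \<le> \<beta>")
    case True
    then show ?thesis using assms by (simp add: cb_deriv_zero)
  next
    case False
    then obtain \<gamma> where \<gamma>: "\<gamma> < \<alpha>" by (auto simp: not_le)
    show ?thesis
    proof (cases "\<exists>\<beta>. ord_succ \<beta> \<alpha>")
      case True
      then obtain \<beta> where \<beta>: "ord_succ \<beta> \<alpha>" ..
      then show ?thesis
        using less[of \<beta>] by (simp add: cb_deriv_succ closed_acc_points ord_succ_def)
    next
      case False
      then show ?thesis using less by (subst cb_deriv_limit[OF \<gamma>]) auto
    qed
  qed
qed

lemma cb_deriv_antimono: "\<beta> \<le> \<alpha> \<Longrightarrow> cb_deriv X \<alpha> \<subseteq> cb_deriv X \<beta>"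
proof (induction \<alpha> rule: less_induct)
  case (less \<alpha>)
  show ?case
  proof (cases "\<beta> = \<alpha>")
    case False
    then have lt: "\<beta> < \<alpha>" using less.prems by simp
    show ?thesis
    proof (cases "\<exists>\<gamma>. ord_succ \<gamma> \<alpha>")
      case True
      then obtain \<gamma> where \<gamma>: "ord_succ \<gamma> \<alpha>" ..
      then have "cb_deriv X \<gamma> \<subseteq> cb_deriv X \<beta>"
        using lt less.IH[of \<gamma>] by (auto simp: ord_succ_def)
      then show ?thesis by (auto simp: cb_deriv_succ[OF \<gamma>] acc_points_def)
    next
      case False
      then show ?thesis using lt by (subst cb_deriv_limit[OF lt]) auto
    qed
  qed simp
qed

section \<open>Separation and bump functions in compact Hausdorff spaces\<close>

lemma infinite_disjoint_open_family:
  fixes A :: "'a::t2_space set"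
  assumes "compact (UNIV :: 'a set)" "infinite A"
  obtains U :: "nat \<Rightarrow> 'a set"
    where "\<And>n. open (U n)" "\<And>n. A \<inter> U n \<noteq> {}" "disjoint_family U"
proof -
  \<comment> \<open>The sets are peeled off along shrinking neighbourhoods of an accumulation point
    \<open>p\<close>: each \<open>U n\<close> misses \<open>N n\<close>, and \<open>N n\<close>
    contains \<open>p\<close> and all later sets.\<close>
  obtain p where p: "p islimpt A"
    using Heine_Borel_imp_Bolzano_Weierstrass[OF assms] by auto
  let ?P = "\<lambda>n (U, N). open U \<and> open N \<and> p \<in> N \<and> U \<inter> N = {} \<and> A \<inter> U \<noteq> {}"
  let ?Q = "\<lambda>n (U, N) (U', N'). U' \<union> N' \<subseteq> N"
  have step: "\<exists>U N'. open U \<and> open N' \<and> p \<in> N' \<and> U \<inter> N' = {} \<and> A \<inter> U \<noteq> {} \<and> U \<union> N' \<subseteq> N"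
    if N: "open N" "p \<in> N" for N
  proof -
    obtain a where a: "a \<in> A" "a \<in> N" "a \<noteq> p" using islimptE[OF p N(2,1)] by blast
    obtain U N' where "open U" "open N'" "a \<in> U" "p \<in> N'" "U \<inter> N' = {}"
      using hausdorff[OF a(3)] by blast
    then show ?thesis using a N by (intro exI[of _ "U \<inter> N"] exI[of _ "N' \<inter> N"]) auto
  qed
  have "\<exists>f. \<forall>n. ?P n (f n) \<and> ?Q n (f n) (f (Suc n))"
  proof (rule dependent_nat_choice)
    show "\<exists>x. ?P 0 x" using step[of UNIV] by auto
    fix x n assume "?P n x"
    then show "\<exists>y. ?P (Suc n) y \<and> ?Q n x y" using step[of "snd x"] by (auto simp: case_prod_beta)
  qed
  then obtain f where f: "\<forall>n. ?P n (f n) \<and> ?Q n (f n) (f (Suc n))" ..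
  define U N where "U n = fst (f n)" and "N n = snd (f n)" for n
  have U: "open (U n)" "U n \<inter> N n = {}" "A \<inter> U n \<noteq> {}" "U (Suc n) \<union> N (Suc n) \<subseteq> N n" for n
    using spec[OF f, of n] by (simp_all add: U_def N_def case_prod_beta)
  have dec: "N m \<subseteq> N n" if "n \<le> m" for n m
    by (rule lift_Suc_antimono_le[OF _ that]) (use U(4) in blast)
  have disj: "U m \<inter> U n = {}" if less: "n < m" for n m
  proof -
    obtain k where k: "m = Suc k" "n \<le> k" using less_imp_Suc_add[OF less] by auto
    then have "U m \<subseteq> N n" using U(4)[of k] dec[of n k] by auto
    then show ?thesis using U(2)[of n] by auto
  qed
  have "U m \<inter> U n = {}" if "m \<noteq> n" for n m
    using that disj[of m n] disj[of n m] by (cases m n rule: linorder_cases) auto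
  then have "disjoint_family U" by (simp add: disjoint_family_on_def)
  with U(1,3) show ?thesis by (rule that)
qed

lemma finite_disjoint_neighbourhoods:
  fixes I :: "'a::t2_space set"
  assumes "finite I"
  obtains N where "\<And>x. x \<in> I \<Longrightarrow> open (N x) \<and> x \<in> N x" "disjoint_family_on N I"
proof -
  have "\<exists>N. (\<forall>x\<in>I. open (N x) \<and> x \<in> N x) \<and> disjoint_family_on N I"
    using assms
  proof (induction I)
    case (insert z I)
    then obtain N where N: "\<And>x. x \<in> I \<Longrightarrow> open (N x) \<and> x \<in> N x" "disjoint_family_on N I" by blast
    have "\<forall>x\<in>I. \<exists>U V. open U \<and> open V \<and> x \<in> U \<and> z \<in> V \<and> U \<inter> V = {}"
      using insert.hyps(2) hausdorff by metis
    then obtain U V where UV: "\<And>x. x \<in> I \<Longrightarrow> open (U x) \<and> open (V x) \<and> x \<in> U x \<and> z \<in> V x \<and> U x \<inter> V x = {}"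
      by metis
    let ?N = "\<lambda>x. if x = z then (\<Inter>x\<in>I. V x) else N x \<inter> U x"
    have "\<forall>x\<in>insert z I. open (?N x) \<and> x \<in> ?N x"
      using UV N insert.hyps by auto
    moreover have "disjoint_family_on ?N (insert z I)"
      using UV N(2) insert.hyps(2) by (fastforce simp: disjoint_family_on_def)
    ultimately show ?case by (intro exI[of _ ?N] conjI)
  qed (simp add: disjoint_family_on_def)
  then obtain N where "\<forall>x\<in>I. open (N x) \<and> x \<in> N x" "disjoint_family_on N I" by auto
  then show ?thesis by (intro that[of N]) auto
qed

lemma normal_space_compact_t2:
  assumes "compact (UNIV :: 'a::t2_space set)"
  shows "normal_space (euclidean :: 'a topology)"
proof -
  have "Hausdorff_space (euclidean :: 'a topology)"
    unfolding Hausdorff_space_def disjnt_def using hausdorff by auto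
  moreover have "compact_space (euclidean :: 'a topology)" using assms by (simp add: compact_space_def)
  ultimately show ?thesis using compact_Hausdorff_or_regular_imp_normal_space by blast
qed

lemma compact_regular:
  fixes x :: "'a::t2_space"
  assumes "compact (UNIV :: 'a set)" "open U" "x \<in> U"
  obtains V where "open V" "x \<in> V" "closure V \<subseteq> U"
proof -
  have sep: "\<exists>V W. open V \<and> open W \<and> S \<subseteq> V \<and> T \<subseteq> W \<and> disjnt V W"
    if "closed S" "closed T" "disjnt S T" for S T :: "'a set"
    using normal_space_compact_t2[OF assms(1)] that by (simp add: normal_space_def)
  have "disjnt {x} (- U)" using assms(3) by (simp add: disjnt_def)
  with sep[of "{x}" "- U"] assms(2) obtain V W
    where VW: "open V" "open W" "{x} \<subseteq> V" "- U \<subseteq> W" "disjnt V W" by auto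
  then have "closure V \<subseteq> - W" by (intro closure_minimal) (auto simp: disjnt_def)
  then have "closure V \<subseteq> U" using VW(4) by blast
  then show ?thesis using VW by (intro that[of V]) auto
qed

abbreviation supp :: "('a::topological_space \<Rightarrow>\<^sub>C real) \<Rightarrow> 'a set"
  where "supp f \<equiv> closure {z. apply_bcontfun f z \<noteq> 0}"

lemma bump_function:
  fixes x :: "'a::t2_space"
  assumes K: "compact (UNIV :: 'a set)" and U: "open U" "x \<in> U"
  obtains f :: "'a \<Rightarrow>\<^sub>C real" and N
  where "\<forall>z. 0 \<le> f z \<and> f z \<le> 1" "supp f \<subseteq> U" "open N" "x \<in> N" "\<forall>z\<in>N. f z = 1"
proof -
  obtain V where V: "open V" "x \<in> V" "closure V \<subseteq> U" using compact_regular[OF K U] .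
  \<comment> \<open>Shrinking twice leaves room on both sides: the function is 1 on all of
    \<open>N\<close>, and its closed support stays inside \<open>U\<close>.\<close>
  obtain N where N: "open N" "x \<in> N" "closure N \<subseteq> V" using compact_regular[OF K V(1,2)] .
  have sep: "disjnt (- V) (closure N)" using N(3) by (auto simp: disjnt_def)
  have cl: "closedin euclidean (- V)" "closedin euclidean (closure N)" using V(1) by auto
  obtain g :: "'a \<Rightarrow> real" where g: "continuous_map euclidean (top_of_set {0..1}) g"
      "g ` (- V) \<subseteq> {0}" "g ` closure N \<subseteq> {1}"
    by (rule Urysohn_lemma[OF normal_space_compact_t2[OF K] cl sep zero_le_one])
  have g01: "0 \<le> g z \<and> g z \<le> 1" for z
    using g(1) by (auto simp: continuous_map_in_subtopology)
  have "continuous_on UNIV g" using g(1) by (auto simp: continuous_map_in_subtopology)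
  then have "g \<in> bcontfun" using g01 by (intro bcontfun_normI[of _ 1]) auto
  then obtain f where f: "g = apply_bcontfun f" by (rule bcontfunE)
  have "{z. apply_bcontfun f z \<noteq> 0} \<subseteq> V" using g(2) f by auto
  then have "supp f \<subseteq> U" using V(3) closure_mono by blast
  moreover have "f z = 1" if "z \<in> N" for z using g(3) that closure_subset f by auto
  ultimately show ?thesis using g01 N(1,2) f by (intro that[of f N]) auto
qed

section \<open>Reduction to infinite families and infinite discrete sets\<close>

lemma infinite_disjoint_open_set:
  fixes A :: "'a::t2_space set"
  assumes "compact (UNIV :: 'a set)" "infinite A"
  obtains \<U> where "infinite \<U>" "point_bounded \<U>" "\<forall>U\<in>\<U>. open U \<and> U \<noteq> {}" "meeting \<U> A"
proof -
  obtain U :: "nat \<Rightarrow> 'a set" where U: "\<And>n. open (U n)" "\<And>n. A \<inter> U n \<noteq> {}" "disjoint_family U"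
    by (rule infinite_disjoint_open_family[OF assms]) (rule that; blast)
  have disj: "m = n" if "x \<in> U m" "x \<in> U n" for m n x
    using that U(3) by (auto simp: disjoint_family_on_def)
  have ne: "U n \<noteq> {}" for n using U(2)[of n] by auto
  have "inj U"
  proof (rule injI)
    fix m n assume "U m = U n"
    then show "m = n" using ne[of m] disj[of _ m n] by auto
  qed
  then have "infinite (range U)" by (rule range_inj_infinite)
  moreover have "point_bounded (range U)"
    unfolding point_bounded_def
  proof (intro exI allI)
    fix x
    show "finite {V \<in> range U. x \<in> V} \<and> card {V \<in> range U. x \<in> V} \<le> 1"
    proof (rule finite_if_finite_subsets_card_bdd)
      fix G assume "G \<subseteq> {V \<in> range U. x \<in> V}" "finite G"
      then have "V = W" if "V \<in> G" "W \<in> G" for V W using that disj by blast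
      then show "card G \<le> 1" using \<open>finite G\<close> by (auto simp: card_le_Suc0_iff_eq)
    qed
  qed
  moreover have "\<forall>V\<in>range U. open V \<and> V \<noteq> {}" using U(1) ne by auto
  moreover have "meeting (range U) A" using U(2) by (auto simp: meeting_def)
  ultimately show ?thesis by (rule that)
qed

text \<open>An infinite set meets infinitely many disjoint open sets, and this infinite family
  dominates every finite one. Only infinite families remain, for which finite fibres preserve
  cardinality.\<close>

lemma c_pb_le_if_infinite:
  fixes A :: "'a::t2_space set" and r :: "'c rel"
  assumes K: "compact (UNIV :: 'a set)" and inf: "infinite A" and r: "Card_order r"
    and le: "\<And>\<U>. infinite \<U> \<Longrightarrow> point_bounded \<U> \<Longrightarrow> (\<forall>U\<in>\<U>. open U \<and> U \<noteq> {}) \<Longrightarrow> meeting \<U> A \<Longrightarrow> |\<U>| \<le>o r"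
  shows "c_pb A \<le>o r"
  unfolding c_pb_def
proof (subst card_Sup_le_iff[OF r], rule ballI)
  fix \<U> assume \<U>: "\<U> \<in> {\<U>. point_bounded \<U> \<and> (\<forall>U\<in>\<U>. open U \<and> U \<noteq> {}) \<and> meeting \<U> A}"
  show "|\<U>| \<le>o r"
  proof (cases "finite \<U>")
    case True
    obtain \<U>' where \<U>': "infinite \<U>'" "point_bounded \<U>'" "\<forall>U\<in>\<U>'. open U \<and> U \<noteq> {}" "meeting \<U>' A"
      by (rule infinite_disjoint_open_set[OF K inf])
    have "|\<U>| \<le>o |\<U>'|"
      using finite_card_of_less_infinite[OF True \<U>'(1)] by (rule ordLess_imp_ordLeq)
    then show ?thesis using le[OF \<U>'] by (rule ordLeq_transitive)
  qed (use le \<U> in auto)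
qed

lemma spread_le_if_infinite:
  fixes A :: "'a::t2_space set" and r :: "'c rel"
  assumes K: "compact (UNIV :: 'a set)" and inf: "infinite A" and r: "Card_order r"
    and le: "\<And>D. infinite D \<Longrightarrow> D \<subseteq> A \<Longrightarrow> discrete D \<Longrightarrow> |D| \<le>o r"
  shows "spread A \<le>o r"
  unfolding spread_def
proof (subst card_Sup_le_iff[OF r], rule ballI)
  fix D assume D: "D \<in> {D. D \<subseteq> A \<and> discrete D}"
  show "|D| \<le>o r"
  proof (cases "finite D")
    case True
    obtain U :: "nat \<Rightarrow> 'a set" where U: "\<And>n. open (U n)" "\<And>n. A \<inter> U n \<noteq> {}" "disjoint_family U"
      by (rule infinite_disjoint_open_family[OF K inf]) (rule that; blast)
    have "\<forall>n. \<exists>a. a \<in> A \<inter> U n" using U(2) by auto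
    then obtain a where a: "\<And>n. a n \<in> A \<inter> U n" by metis
    have eq: "m = n" if "a m \<in> U n" for m n
      using that a[of m] U(3) by (auto simp: disjoint_family_on_def)
    have "inj a" using a eq by (metis IntD2 injI)
    then have inf': "infinite (range a)" by (rule range_inj_infinite)
    \<comment> \<open>One point from each of the disjoint open sets: \<open>U n\<close> isolates
      \<open>a n\<close> from the others.\<close>
    have "discrete (range a)"
    proof (rule discreteI)
      fix x assume "x \<in> range a"
      then obtain n where n: "x = a n" by auto
      have "U n \<inter> range a = {x}" using a[of n] eq n by auto
      then show "x isolated_in range a" unfolding isolated_in_def using U(1) n by auto
    qed
    then have "|range a| \<le>o r" using a by (intro le[OF inf']) auto
    then show ?thesis
      using ordLess_imp_ordLeq[OF finite_card_of_less_infinite[OF True inf']] ordLeq_transitive by blast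
  qed (use le D in auto)
qed

section \<open>Embeddings with distortion less than 3\<close>

lemma apply_bcontfun_sum: "apply_bcontfun (sum g I) z = (\<Sum>i\<in>I. apply_bcontfun (g i) z)"
  for g :: "'i \<Rightarrow> 'a::topological_space \<Rightarrow>\<^sub>C 'b::real_normed_vector"
  by (induction I rule: infinite_finite_induct) auto

lemma norm_sum_overlap_le:
  fixes f :: "'i \<Rightarrow> 'a::topological_space \<Rightarrow>\<^sub>C real"
  assumes "finite I" and f: "\<And>i z. i \<in> I \<Longrightarrow> \<bar>f i z\<bar> \<le> 1" and s: "\<And>i. i \<in> I \<Longrightarrow> \<bar>s i\<bar> \<le> 1"
    and k: "\<And>z. card {i \<in> I. f i z \<noteq> 0} \<le> k"
  shows "norm (\<Sum>i\<in>I. s i *\<^sub>R f i) \<le> of_nat k"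
proof (rule norm_bound)
  fix z
  let ?J = "{i \<in> I. f i z \<noteq> 0}"
  have "apply_bcontfun (\<Sum>i\<in>I. s i *\<^sub>R f i) z = (\<Sum>i\<in>I. s i * f i z)"
    by (simp add: apply_bcontfun_sum)
  also have "\<dots> = (\<Sum>i\<in>?J. s i * f i z)"
    using \<open>finite I\<close> by (intro sum.mono_neutral_right) auto
  also have "\<bar>\<dots>\<bar> \<le> (\<Sum>i\<in>?J. 1)"
    by (rule order_trans[OF sum_abs], rule sum_mono) (auto simp: abs_mult intro!: mult_le_one f s)
  also have "\<dots> \<le> of_nat k" using k[of z] by simp
  finally show "norm (apply_bcontfun (\<Sum>i\<in>I. s i *\<^sub>R f i) z) \<le> of_nat k" by simp
qed

text \<open>The value 1 on a neighbourhood, not merely at \<open>x\<close>, makes finitely many such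
  functions peak at all points near \<open>x\<close> as well; this is what the passage to
  accumulation points relies on.\<close>

definition peaks :: "'a::topological_space \<Rightarrow> ('a \<Rightarrow>\<^sub>C real) set"
  where "peaks x = {f :: 'a \<Rightarrow>\<^sub>C real. (\<forall>z. 0 \<le> f z \<and> f z \<le> 1) \<and> (\<exists>N. open N \<and> x \<in> N \<and> (\<forall>z\<in>N. f z = 1))}"

lemma peak_le_1: "f \<in> peaks x \<Longrightarrow> \<bar>apply_bcontfun f z\<bar> \<le> 1"
  by (auto simp: peaks_def)

lemma peaks_supported:
  fixes x :: "'a::t2_space"
  assumes "compact (UNIV :: 'a set)" "open U" "x \<in> U"
  obtains f where "f \<in> peaks x" "supp f \<subseteq> U"
proof -
  obtain f :: "'a \<Rightarrow>\<^sub>C real" and N where f: "\<forall>z. 0 \<le> f z \<and> f z \<le> 1" "supp f \<subseteq> U"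
    and N: "open N" "x \<in> N" "\<forall>z\<in>N. f z = 1"
    by (rule bump_function[OF assms])
  then have "f \<in> peaks x" by (auto simp: peaks_def)
  then show ?thesis using f(2) by (rule that)
qed

lemma peaks_common_neighbourhood:
  assumes "finite F" "F \<subseteq> peaks x"
  obtains N where "open N" "x \<in> N" "\<forall>f\<in>F. \<forall>z\<in>N. apply_bcontfun f z = 1"
proof -
  have "\<forall>f\<in>F. \<exists>N. open N \<and> x \<in> N \<and> (\<forall>z\<in>N. apply_bcontfun f z = 1)"
    using assms(2) by (auto simp: peaks_def)
  then obtain N where N: "\<forall>f\<in>F. open (N f) \<and> x \<in> N f \<and> (\<forall>z\<in>N f. apply_bcontfun f z = 1)"
    by (rule bchoice[THEN exE])
  show ?thesis
  proof (rule that)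
    show "open (\<Inter>f\<in>F. N f)" using assms(1) N by auto
  qed (use N in auto)
qed

lemma peaks_neighbourhood:
  assumes "finite F" "F \<subseteq> peaks x"
  obtains N where "open N" "x \<in> N" "\<forall>x'\<in>N. F \<subseteq> peaks x'"
proof -
  obtain N where N: "open N" "x \<in> N" "\<forall>f\<in>F. \<forall>z\<in>N. apply_bcontfun f z = 1"
    by (rule peaks_common_neighbourhood[OF assms])
  have "\<forall>x'\<in>N. F \<subseteq> peaks x'"
    using assms(2) N(1,3) unfolding peaks_def by blast
  with N(1,2) show ?thesis by (rule that)
qed

text \<open>The common consequence of cotype and of the absence of \<open>c0\<close>. One small term
  is enough to ask for, since it is applied to sequences consisting of large terms only.\<close>

definition vanishing_wuc :: "'e::real_normed_vector itself \<Rightarrow> bool"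
  where "vanishing_wuc _ \<longleftrightarrow> (\<forall>(e :: nat \<Rightarrow> 'e) \<epsilon>. wuc e \<longrightarrow> 0 < \<epsilon> \<longrightarrow> (\<exists>i. norm (e i) < \<epsilon>))"

lemma not_contains_c0_vanishing_wuc:
  assumes "\<not> contains_c0 TYPE('e::banach)"
  shows "vanishing_wuc TYPE('e)"
  unfolding vanishing_wuc_def
proof (intro allI impI)
  fix e :: "nat \<Rightarrow> 'e" and \<epsilon> :: real
  assume "wuc e" "0 < \<epsilon>"
  then have "\<not> (\<forall>i. \<epsilon> \<le> norm (e i))" using bessaga_pelczynski[of e \<epsilon>] assms by blast
  then show "\<exists>i. norm (e i) < \<epsilon>" by (simp add: not_le)
qed

lemma has_cotype_card_le:
  fixes e :: "'i \<Rightarrow> 'e::real_normed_vector"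
  assumes cotype: "has_cotype TYPE('e) q C" and "finite I" and "0 \<le> R"
    and "\<And>s. (\<And>i. i \<in> I \<Longrightarrow> \<bar>s i\<bar> \<le> 1) \<Longrightarrow> norm (\<Sum>i\<in>I. s i *\<^sub>R e i) \<le> R"
    and \<epsilon>: "0 < \<epsilon>" "\<And>i. i \<in> I \<Longrightarrow> \<epsilon> \<le> norm (e i)"
  shows "card I \<le> nat \<lfloor>(C * R) powr q / \<epsilon> powr q\<rfloor>"
proof -
  have q: "2 \<le> q" using cotype by (simp add: has_cotype_def)
  have "of_nat (card I) * \<epsilon> powr q = (\<Sum>i\<in>I. \<epsilon> powr q)" by simp
  also have "\<dots> \<le> (\<Sum>i\<in>I. norm (e i) powr q)"
    using \<epsilon> q by (intro sum_mono powr_mono2) auto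
  also have "\<dots> \<le> (C * R) powr q" by (rule has_cotype_sum_le) fact+
  finally have "of_nat (card I) \<le> (C * R) powr q / \<epsilon> powr q" using \<epsilon>(1) by (simp add: field_simps)
  then show ?thesis by (rule le_nat_floor)
qed

lemma has_cotype_vanishing_wuc:
  assumes cotype: "has_cotype TYPE('e::real_normed_vector) q C"
  shows "vanishing_wuc TYPE('e)"
  unfolding vanishing_wuc_def
proof (intro allI impI)
  fix e :: "nat \<Rightarrow> 'e" and \<epsilon> :: real
  assume "wuc e" and \<epsilon>: "0 < \<epsilon>"
  obtain B where B: "0 < B"
    "\<And>I a c. finite I \<Longrightarrow> 0 \<le> c \<Longrightarrow> (\<And>i. i \<in> I \<Longrightarrow> \<bar>a i\<bar> \<le> c) \<Longrightarrow> norm (\<Sum>i\<in>I. a i *\<^sub>R e i) \<le> B * c"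
    by (rule wucE[OF \<open>wuc e\<close>]) (rule that; blast)
  let ?n = "nat \<lfloor>(C * B) powr q / \<epsilon> powr q\<rfloor>"
  show "\<exists>i. norm (e i) < \<epsilon>"
  proof (rule ccontr)
    assume "\<nexists>i. norm (e i) < \<epsilon>"
    \<comment> \<open>This is one term more than the cotype bound \<open>?n\<close> allows.\<close>
    then have "card {..<Suc ?n} \<le> ?n"
      using B(1) B(2)[of "{..<Suc ?n}" 1] \<epsilon> by (intro has_cotype_card_le[OF cotype, of _ _ e]) (auto simp: not_less)
    then show False by simp
  qed
qed

lemma bcontfun_cut_off:
  fixes f h :: "'a::topological_space \<Rightarrow>\<^sub>C real"
  assumes "\<forall>z. \<bar>f z\<bar> \<le> 1" and h: "\<forall>z. 0 \<le> h z \<and> h z \<le> 1"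
  obtains g where "\<forall>z. apply_bcontfun g z = f z * h z"
proof -
  have "(\<lambda>z. f z * h z) \<in> bcontfun"
  proof (rule bcontfun_normI)
    show "continuous_on UNIV (\<lambda>z. f z * h z)" by (intro continuous_intros) auto
    show "norm (f z * h z) \<le> 1" for z
      using assms by (auto simp: abs_mult intro!: mult_le_one)
  qed
  then obtain g where "(\<lambda>z. f z * h z) = apply_bcontfun g" by (rule bcontfunE)
  then show ?thesis by (intro that[of g]) metis
qed

text \<open>Closed supports lie in \<open>W\<close>, while disjointness is required pointwise only.
  The system is a set, so each function enters a sum once.\<close>

definition disjoint_system :: "'a::topological_space set \<Rightarrow> ('a \<Rightarrow>\<^sub>C real) set \<Rightarrow> bool"
  where "disjoint_system W F \<longleftrightarrow> finite F \<and>
    (\<forall>f\<in>F. (\<forall>z. \<bar>apply_bcontfun f z\<bar> \<le> 1) \<and> supp f \<subseteq> W) \<and>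
    (\<forall>f\<in>F. \<forall>g\<in>F. f \<noteq> g \<longrightarrow> (\<forall>z. apply_bcontfun f z = 0 \<or> apply_bcontfun g z = 0))"

lemma disjoint_system_overlap:
  assumes "disjoint_system W F"
  shows "card {f \<in> F. apply_bcontfun f z \<noteq> 0} \<le> 1"
proof -
  have "finite {f \<in> F. apply_bcontfun f z \<noteq> 0}" using assms by (simp add: disjoint_system_def)
  moreover have "f = g" if "f \<in> F" "g \<in> F" "apply_bcontfun f z \<noteq> 0" "apply_bcontfun g z \<noteq> 0" for f g
    using assms that unfolding disjoint_system_def by blast
  ultimately show ?thesis by (auto simp: card_le_Suc0_iff_eq)
qed

text \<open>\<open>M\<close> bounds the norm of \<open>T\<close> and \<open>L\<close> that of its
  inverse; at the end they become \<open>onorm T\<close> and \<open>onorm_inverse T\<close>.\<close>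

locale embedding =
  fixes T :: "('k1::t2_space \<Rightarrow>\<^sub>C real) \<Rightarrow> ('k2::t2_space \<Rightarrow>\<^sub>C 'e::banach)" and L M :: real
  assumes compact1: "compact (UNIV :: 'k1 set)" and compact2: "compact (UNIV :: 'k2 set)"
    and T: "bounded_linear T"
    and upper: "norm (T f) \<le> M * norm f" and lower: "norm f \<le> L * norm (T f)"
    and L: "0 < L" and LM: "L * M < 3"
begin

lemma linear_eval: "linear (\<lambda>f. apply_bcontfun (T f) y)"
  using bounded_linear.linear[OF T] by (intro linearI) (simp_all add: linear_add linear_scale)

lemma eval_sum: "(\<Sum>i\<in>I. s i *\<^sub>R T (f i) y) = apply_bcontfun (T (\<Sum>i\<in>I. s i *\<^sub>R f i)) y"
  by (simp add: linear_sum[OF linear_eval] linear_scale[OF linear_eval])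

lemma norm_eval_le: "norm (T f y) \<le> M * norm f"
  using norm_bounded upper by (rule order_trans)

lemma M_nonneg: "0 \<le> M"
proof -
  have "1 \<le> norm (const_bcontfun 1 :: 'k1 \<Rightarrow>\<^sub>C real)"
    using norm_bounded[of "const_bcontfun 1 :: 'k1 \<Rightarrow>\<^sub>C real" undefined] by simp
  moreover have "0 \<le> M * norm (const_bcontfun 1 :: 'k1 \<Rightarrow>\<^sub>C real)"
    using norm_ge_zero upper by (rule order_trans)
  ultimately show ?thesis by (smt (verit) mult_neg_pos)
qed

lemma closed_ge: "closed {y. c \<le> norm (T f y)}"
  by (intro closed_Collect_le continuous_intros) auto

lemma open_greater: "open {y. c < norm (T f y)}"
  by (intro open_Collect_less continuous_intros) auto

lemma eval_sum_overlap_le: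
  fixes f :: "'i \<Rightarrow> 'k1 \<Rightarrow>\<^sub>C real"
  assumes "finite I" "\<And>i z. i \<in> I \<Longrightarrow> \<bar>f i z\<bar> \<le> 1" "\<And>i. i \<in> I \<Longrightarrow> \<bar>s i\<bar> \<le> 1"
    and "\<And>z. card {i \<in> I. f i z \<noteq> 0} \<le> k"
  shows "norm (\<Sum>i\<in>I. s i *\<^sub>R T (f i) y) \<le> M * of_nat k"
proof -
  have "norm (\<Sum>i\<in>I. s i *\<^sub>R T (f i) y) \<le> M * norm (\<Sum>i\<in>I. s i *\<^sub>R f i)"
    unfolding eval_sum by (rule norm_eval_le)
  also have "\<dots> \<le> M * of_nat k"
    using norm_sum_overlap_le[of I f s k] assms M_nonneg by (intro mult_left_mono) auto
  finally show ?thesis .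
qed

text \<open>Infinitely many large values at \<open>y\<close> would form a sequence that is weakly
  unconditionally Cauchy by the bounded overlap of the functions, yet has no small term.\<close>

lemma finite_large:
  fixes f :: "'i \<Rightarrow> 'k1 \<Rightarrow>\<^sub>C real"
  assumes van: "vanishing_wuc TYPE('e)" and f: "\<And>i z. i \<in> J \<Longrightarrow> \<bar>f i z\<bar> \<le> 1"
    and k: "\<And>z. finite {i \<in> J. f i z \<noteq> 0} \<and> card {i \<in> J. f i z \<noteq> 0} \<le> k"
    and \<epsilon>: "0 < \<epsilon>"
  shows "finite {i \<in> J. \<epsilon> \<le> norm (T (f i) y)}"
proof (rule ccontr)
  assume inf: "infinite {i \<in> J. \<epsilon> \<le> norm (T (f i) y)}"
  obtain g :: "nat \<Rightarrow> 'i" where g: "inj g" "range g \<subseteq> {i \<in> J. \<epsilon> \<le> norm (T (f i) y)}"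
    using iffD1[OF infinite_iff_countable_subset inf] by auto
  have "norm (\<Sum>n\<in>I. a n *\<^sub>R T (f (g n)) y) \<le> M * of_nat k"
    if I: "finite I" and a: "\<forall>n\<in>I. \<bar>a n\<bar> \<le> 1" for I and a :: "nat \<Rightarrow> real"
  proof (rule eval_sum_overlap_le[where f = "\<lambda>n. f (g n)"])
    show "card {n \<in> I. apply_bcontfun (f (g n)) z \<noteq> 0} \<le> k" for z
    proof -
      have "card {n \<in> I. apply_bcontfun (f (g n)) z \<noteq> 0} = card (g ` {n \<in> I. apply_bcontfun (f (g n)) z \<noteq> 0})"
        by (rule card_image[symmetric, OF inj_on_subset[OF g(1)]]) simp
      also have "\<dots> \<le> card {i \<in> J. f i z \<noteq> 0}"
        using g(2) k by (intro card_mono) auto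
      also have "\<dots> \<le> k" using k by blast
      finally show ?thesis .
    qed
    show "\<bar>f (g n) z\<bar> \<le> 1" for n z using f[of "g n"] g(2) by auto
  qed (use I a in auto)
  then have "wuc (\<lambda>n. T (f (g n)) y)" unfolding wuc_def by blast
  then obtain n where "norm (T (f (g n)) y) < \<epsilon>" using van \<epsilon> unfolding vanishing_wuc_def by blast
  moreover have "\<epsilon> \<le> norm (T (f (g n)) y)" using g(2) by auto
  ultimately show False by simp
qed

text \<open>The bound does not depend on \<open>y\<close>; this uniformity later turns point-finite
  into point-bounded.\<close>

lemma card_large:
  fixes f :: "'i \<Rightarrow> 'k1 \<Rightarrow>\<^sub>C real"
  assumes cotype: "has_cotype TYPE('e) q C" and f: "\<And>i z. i \<in> J \<Longrightarrow> \<bar>f i z\<bar> \<le> 1"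
    and k: "\<And>z. finite {i \<in> J. f i z \<noteq> 0} \<and> card {i \<in> J. f i z \<noteq> 0} \<le> k"
    and \<epsilon>: "0 < \<epsilon>"
  shows "card {i \<in> J. \<epsilon> \<le> norm (T (f i) y)} \<le> nat \<lfloor>(C * (M * of_nat k)) powr q / \<epsilon> powr q\<rfloor>"
proof (rule has_cotype_card_le[OF cotype, where e = "\<lambda>i. T (f i) y"])
  let ?I = "{i \<in> J. \<epsilon> \<le> norm (T (f i) y)}"
  show fin: "finite ?I"
    using finite_large[OF has_cotype_vanishing_wuc[OF cotype] f k \<epsilon>] .
  show "norm (\<Sum>i\<in>?I. s i *\<^sub>R T (f i) y) \<le> M * of_nat k"
    if s: "\<And>i. i \<in> ?I \<Longrightarrow> \<bar>s i\<bar> \<le> 1" for s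
  proof (rule eval_sum_overlap_le[OF fin])
    show "card {i \<in> ?I. f i z \<noteq> 0} \<le> k" for z
      by (rule order_trans[OF card_mono]) (use k[of z] in auto)
    show "\<bar>s i\<bar> \<le> 1" if "i \<in> ?I" for i using that by (rule s)
    show "\<bar>f i z\<bar> \<le> 1" if "i \<in> ?I" for i z using that by (intro f) simp
  qed
qed (simp_all add: M_nonneg \<epsilon>)

text \<open>This is \<open>3/2 (1/L - M/3)\<close>, the lower bound obtained in
  \<open>peak_images_nonempty\<close>; it is positive because \<open>L * M < 3\<close>.\<close>

definition \<delta> where "\<delta> = (3 / L - M) / 2"

lemma \<delta>_pos: "0 < \<delta>"
  using L LM by (simp add: \<delta>_def field_simps)

section \<open>Image sets of points and the Cantor-Bendixson derivatives\<close>

definition peak_images where "peak_images x = {y. \<forall>f\<in>peaks x. \<delta> \<le> norm (T f y)}"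

lemma peak_images_eq: "peak_images x = (\<Inter>f\<in>peaks x. {y. \<delta> \<le> norm (T f y)})"
  by (auto simp: peak_images_def)

lemma closed_peak_images: "closed (peak_images x)"
  unfolding peak_images_eq using closed_ge by blast

text \<open>
  If \<open>\<phi>\<close> peaks at \<open>x\<close> and \<open>f = 1\<close> on its support, then \<open>h = 1/3 + 2/3 \<phi>\<close> has norm 1 while
  \<open>h - 2/3 f\<close> has norm at most 1/3. So where \<open>T h\<close> attains its norm, \<open>T f\<close> is at least
  \<open>3/2 (1/L - M/3)\<close>.
\<close>

lemma peak_images_nonempty: "peak_images x \<noteq> {}"
proof -
  \<comment> \<open>By compactness a common point for finitely many peak functions suffices.\<close>
  have "UNIV \<inter> (\<Inter>f\<in>peaks x. {y. \<delta> \<le> norm (T f y)}) \<noteq> {}"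
  proof (rule compact_imp_fip_image[OF compact2 closed_ge])
    fix F assume F: "finite F" "F \<subseteq> peaks x"
    obtain N where N: "open N" "x \<in> N" "\<forall>f\<in>F. \<forall>z\<in>N. apply_bcontfun f z = 1"
      by (rule peaks_common_neighbourhood[OF F])
    obtain \<phi> where \<phi>: "\<phi> \<in> peaks x" "supp \<phi> \<subseteq> N"
      by (rule peaks_supported[OF compact1 N(1,2)])
    have \<phi>0: "\<phi> z = 0" if "z \<notin> N" for z
      using \<phi>(2) that closure_subset[of "{z. \<phi> z \<noteq> 0}"] by auto
    have \<phi>01: "0 \<le> \<phi> z" "\<phi> z \<le> 1" for z using \<phi>(1) by (auto simp: peaks_def)
    have \<phi>x: "\<phi> x = 1" using \<phi>(1) by (auto simp: peaks_def)
    define h :: "'k1 \<Rightarrow>\<^sub>C real" where "h = (1 / 3) *\<^sub>R const_bcontfun 1 + (2 / 3) *\<^sub>R \<phi>"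
    have h: "h z = 1 / 3 + 2 / 3 * \<phi> z" for z by (simp add: h_def)
    have "1 \<le> norm h" using norm_bounded[of h x] by (simp add: h \<phi>x)
    then have "1 \<le> L * norm (T h)" using lower[of h] by simp
    then have Th: "1 / L \<le> norm (T h)" using L by (simp add: field_simps)
    obtain y where y: "\<And>y'. norm (T h y') \<le> norm (T h y)"
      using continuous_attains_sup[OF compact2, of "\<lambda>y. norm (T h y)"]
      by (auto intro!: continuous_intros)
    then have Thy: "1 / L \<le> norm (T h y)" using norm_bound[of "T h"] Th by (meson order_trans)
    have "\<delta> \<le> norm (T f y)" if f: "f \<in> F" for f
    proof -
      have f01: "0 \<le> f z" "f z \<le> 1" for z using f F(2) by (auto simp: peaks_def)
      \<comment> \<open>On \<open>N\<close>, where \<open>f = 1\<close>, the difference is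
        \<open>2/3 \<phi> - 1/3\<close>; off \<open>N\<close>, where \<open>\<phi> = 0\<close>, it
        is \<open>1/3 - 2/3 f\<close>. Both lie between -1/3 and 1/3.\<close>
      have "norm (h - (2 / 3) *\<^sub>R f) \<le> 1 / 3"
      proof (rule norm_bound)
        fix z
        show "norm (apply_bcontfun (h - (2 / 3) *\<^sub>R f) z) \<le> 1 / 3"
          using f01[of z] \<phi>01[of z] \<phi>0[of z] bspec[OF N(3) f]
          by (cases "z \<in> N") (simp_all add: h, simp_all add: abs_if)
      qed
      then have "norm (T (h - (2 / 3) *\<^sub>R f) y) \<le> M * (1 / 3)"
        using norm_eval_le M_nonneg by (meson mult_left_mono order_trans)
      moreover have "T (h - (2 / 3) *\<^sub>R f) y = T h y - (2 / 3) *\<^sub>R T f y"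
        by (simp add: linear_diff[OF linear_eval] linear_scale[OF linear_eval])
      ultimately have "norm (T h y) - 2 / 3 * norm (T f y) \<le> M / 3"
        using norm_triangle_ineq2[of "T h y" "(2 / 3) *\<^sub>R T f y"] by simp
      then show ?thesis using Thy by (simp add: \<delta>_def field_simps)
    qed
    then show "UNIV \<inter> (\<Inter>f\<in>F. {y. \<delta> \<le> norm (T f y)}) \<noteq> {}" by auto
  qed
  then show ?thesis by (simp add: peak_images_eq)
qed

text \<open>Infinitely many such points would meet infinitely many disjoint open sets, and bumps in
  these would all be at least \<open>\<delta>\<close> at \<open>y\<close>, against
  \<open>finite_large\<close> with overlap 1.\<close>

lemma finite_peak_images_fibres:
  assumes van: "vanishing_wuc TYPE('e)"
  shows "finite {x. y \<in> peak_images x}"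
proof (rule ccontr)
  assume inf: "infinite {x. y \<in> peak_images x}"
  obtain U :: "nat \<Rightarrow> 'k1 set" where U: "\<And>n. open (U n)" "\<And>n. {x. y \<in> peak_images x} \<inter> U n \<noteq> {}" "disjoint_family U"
    by (rule infinite_disjoint_open_family[OF compact1 inf]) (rule that; blast)
  have "\<exists>f :: 'k1 \<Rightarrow>\<^sub>C real. (\<forall>z. \<bar>apply_bcontfun f z\<bar> \<le> 1) \<and> supp f \<subseteq> U n \<and> \<delta> \<le> norm (T f y)" for n
  proof -
    obtain x where x: "y \<in> peak_images x" "x \<in> U n" using U(2)[of n] by auto
    obtain f :: "'k1 \<Rightarrow>\<^sub>C real" where f: "f \<in> peaks x" "supp f \<subseteq> U n" by (rule peaks_supported[OF compact1 U(1) x(2)])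
    then have "\<delta> \<le> norm (T f y)" using x(1) by (auto simp: peak_images_def)
    then show ?thesis using f peak_le_1[OF f(1)] by (intro exI[of _ f]) simp
  qed
  then obtain f :: "nat \<Rightarrow> 'k1 \<Rightarrow>\<^sub>C real" where f: "\<And>n z. \<bar>apply_bcontfun (f n) z\<bar> \<le> 1" "\<And>n. supp (f n) \<subseteq> U n" "\<And>n. \<delta> \<le> norm (T (f n) y)"
    by metis
  have "finite {n \<in> UNIV. apply_bcontfun (f n) z \<noteq> 0} \<and> card {n \<in> UNIV. apply_bcontfun (f n) z \<noteq> 0} \<le> 1" for z
  proof -
    have "z \<in> U n" if "apply_bcontfun (f n) z \<noteq> 0" for n
      using f(2)[of n] that closure_subset[of "{z. apply_bcontfun (f n) z \<noteq> 0}"] by auto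
    then have "n = m" if "apply_bcontfun (f n) z \<noteq> 0" "apply_bcontfun (f m) z \<noteq> 0" for n m
      using that U(3) unfolding disjoint_family_on_def by blast
    then have "card G \<le> 1" if "G \<subseteq> {n. apply_bcontfun (f n) z \<noteq> 0}" "finite G" for G
      using that by (auto simp: card_le_Suc0_iff_eq)
    then show ?thesis using finite_if_finite_subsets_card_bdd by auto
  qed
  then have "finite {n \<in> UNIV. \<delta> \<le> norm (T (f n) y)}"
    by (intro finite_large[OF van]) (auto simp: f \<delta>_pos)
  then show False using f(3) by simp
qed

theorem peak_images_meet_cb_deriv:
  fixes \<alpha> :: "'o::wellorder"
  assumes van: "vanishing_wuc TYPE('e)" and "x \<in> cb_deriv UNIV \<alpha>"
  shows "peak_images x \<inter> cb_deriv UNIV \<alpha> \<noteq> {}"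
  using assms(2)
proof (induction \<alpha> arbitrary: x rule: less_induct)
  case (less \<alpha>)
  show ?case
  proof (cases "\<forall>\<beta>. \<alpha> \<le> \<beta>")
    case True
    then show ?thesis using peak_images_nonempty by (simp add: cb_deriv_zero)
  next
    case False
    then obtain \<gamma> where \<gamma>: "\<gamma> < \<alpha>" by (auto simp: not_le)
    show ?thesis
    proof (cases "\<exists>\<beta>. ord_succ \<beta> \<alpha>")
      case True
      then obtain \<beta> where \<beta>: "ord_succ \<beta> \<alpha>" ..
      then have "\<beta> < \<alpha>" by (simp add: ord_succ_def)
      let ?A = "cb_deriv (UNIV :: 'k1 set) \<beta>" and ?B = "cb_deriv (UNIV :: 'k2 set) \<beta>"
      have clB: "closed ?B" by (rule closed_cb_deriv) simp
      have x: "x islimpt ?A" using less.prems by (simp add: cb_deriv_succ[OF \<beta>] acc_points_def)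
      \<comment> \<open>Finitely many peak functions at \<open>x\<close> also peak at infinitely
        many nearby points of \<open>?A\<close>. Compactness then passes to all peak functions at
        once.\<close>
      have acc: "acc_points ?B \<inter> (\<Inter>f\<in>F. {y. \<delta> \<le> norm (T f y)}) \<noteq> {}"
        if F: "finite F" "F \<subseteq> peaks x" for F
      proof -
        obtain N where N: "open N" "x \<in> N" "\<forall>x'\<in>N. F \<subseteq> peaks x'"
          by (rule peaks_neighbourhood[OF F])
        have infN: "infinite (N \<inter> ?A)" using x N(1,2) by (simp add: islimpt_eq_acc_point)
        define Y where "Y = {y \<in> ?B. \<exists>x'\<in>N \<inter> ?A. y \<in> peak_images x'}"
        \<comment> \<open>Each nearby point contributes some \<open>y\<close> by induction, and each
          \<open>y\<close> serves only finitely many points.\<close>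
        have "infinite Y"
        proof
          assume "finite Y"
          then have "finite (\<Union>y\<in>Y. {x. y \<in> peak_images x})" using finite_peak_images_fibres[OF van] by blast
          moreover have "N \<inter> ?A \<subseteq> (\<Union>y\<in>Y. {x. y \<in> peak_images x})"
            using less.IH[OF \<open>\<beta> < \<alpha>\<close>] by (fastforce simp: Y_def)
          ultimately show False using infN finite_subset by blast
        qed
        then obtain y where y: "y islimpt Y"
          using Heine_Borel_imp_Bolzano_Weierstrass[OF compact2] by blast
        have "y islimpt ?B" by (rule islimpt_subset[OF y]) (auto simp: Y_def)
        then have "y \<in> acc_points ?B" using clB by (auto simp: acc_points_def closed_limpt)
        moreover have "\<delta> \<le> norm (T f y)" if f: "f \<in> F" for f
        proof -
          have "Y \<subseteq> {y. \<delta> \<le> norm (T f y)}" using N(3) f by (auto simp: Y_def peak_images_def)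
          then have "y islimpt {y. \<delta> \<le> norm (T f y)}" using y islimpt_subset by blast
          then show ?thesis using closed_ge[of \<delta> f] unfolding closed_limpt by blast
        qed
        ultimately show ?thesis by blast
      qed
      have "compact (acc_points ?B)"
        using compact2 closed_acc_points[OF clB] by (metis compact_Int_closed inf_top_left)
      from compact_imp_fip_image[OF this closed_ge acc]
      show ?thesis by (simp add: peak_images_eq cb_deriv_succ[OF \<beta>] Int_commute)
    next
      case False
      have "peak_images x \<inter> (\<Inter>\<beta>\<in>{..<\<alpha>}. cb_deriv UNIV \<beta>) \<noteq> {}"
      proof (rule compact_imp_fip_image)
        show "compact (peak_images x)" using compact2 closed_peak_images by (metis compact_Int_closed inf_top_left)
        show "closed (cb_deriv (UNIV :: 'k2 set) \<beta>)" for \<beta> :: 'o by (rule closed_cb_deriv) simp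
        fix I :: "'o set" assume I: "finite I" "I \<subseteq> {..<\<alpha>}"
        \<comment> \<open>Since derivatives decrease, the one at the largest index suffices;
          \<open>\<gamma>\<close> provides an index when \<open>I\<close> is empty.\<close>
        define \<beta> where "\<beta> = Max (insert \<gamma> I)"
        have "\<beta> \<in> insert \<gamma> I" unfolding \<beta>_def using I(1) by (intro Max_in) auto
        then have "\<beta> < \<alpha>" using \<gamma> I(2) by auto
        then have "peak_images x \<inter> cb_deriv UNIV \<beta> \<noteq> {}"
          using less.prems cb_deriv_antimono[OF less_imp_le] by (intro less.IH) auto
        moreover have "cb_deriv (UNIV :: 'k2 set) \<beta> \<subseteq> (\<Inter>i\<in>I. cb_deriv UNIV i)"
        proof (rule INT_greatest)
          fix i assume "i \<in> I"
          then have "i \<le> \<beta>" unfolding \<beta>_def using I(1) by simp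
          then show "cb_deriv (UNIV :: 'k2 set) \<beta> \<subseteq> cb_deriv UNIV i" by (rule cb_deriv_antimono)
        qed
        ultimately show "peak_images x \<inter> (\<Inter>i\<in>I. cb_deriv UNIV i) \<noteq> {}" by blast
      qed
      then show ?thesis using False by (simp add: cb_deriv_limit[OF \<gamma>])
    qed
  qed
qed

subsection \<open>Point-bounded families\<close>

text \<open>Halving the threshold allows a strict inequality: the set is open and still contains
  \<open>peak_images x\<close> if \<open>f\<close> peaks at \<open>x\<close>.\<close>

definition large_points where "large_points f = {y. \<delta> / 2 < norm (T f y)}"

lemma large_points_meet_cb_deriv:
  fixes \<alpha> :: "'o::wellorder"
  assumes van: "vanishing_wuc TYPE('e)" and U: "open U" "cb_deriv UNIV \<alpha> \<inter> U \<noteq> {}"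
  shows "\<exists>f. (\<forall>z. \<bar>apply_bcontfun f z\<bar> \<le> 1) \<and> (\<forall>z. apply_bcontfun f z \<noteq> 0 \<longrightarrow> z \<in> U) \<and> cb_deriv UNIV \<alpha> \<inter> large_points f \<noteq> {}"
proof -
  obtain x where x: "x \<in> cb_deriv UNIV \<alpha>" "x \<in> U" using U(2) by auto
  obtain y where y: "y \<in> peak_images x" "y \<in> cb_deriv UNIV \<alpha>" using peak_images_meet_cb_deriv[OF van x(1)] by auto
  obtain f :: "'k1 \<Rightarrow>\<^sub>C real" where f: "f \<in> peaks x" "supp f \<subseteq> U"
    by (rule peaks_supported[OF compact1 U(1) x(2)])
  have "y \<in> large_points f" using y(1) f(1) \<delta>_pos by (fastforce simp: peak_images_def large_points_def)
  then show ?thesis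
    using f y(2) peak_le_1[OF f(1)] closure_subset[of "{z. f z \<noteq> 0}"] by (intro exI[of _ f]) auto
qed

lemma point_bounded_transfer:
  fixes \<alpha> :: "'o::wellorder" and \<U> :: "'k1 set set"
  assumes van: "vanishing_wuc TYPE('e)" and "infinite \<U>" and pb: "point_bounded \<U>"
    and \<U>: "\<forall>U\<in>\<U>. open U \<and> U \<noteq> {}" and meet: "meeting \<U> (cb_deriv UNIV \<alpha>)"
  obtains \<V> :: "'k2 set set"
  where "|\<U>| \<le>o |\<V>|" "point_finite \<V>" "\<forall>W\<in>\<V>. open W \<and> W \<noteq> {}" "meeting \<V> (cb_deriv UNIV \<alpha>)"
    "nontrivial_cotype TYPE('e) \<longrightarrow> point_bounded \<V>"
proof -
  obtain k :: nat where k: "\<forall>x. finite {U \<in> \<U>. x \<in> U} \<and> card {U \<in> \<U>. x \<in> U} \<le> k"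
    using pb unfolding point_bounded_def ..
  have "\<forall>U\<in>\<U>. \<exists>f. (\<forall>z. \<bar>apply_bcontfun f z\<bar> \<le> 1) \<and> (\<forall>z. apply_bcontfun f z \<noteq> 0 \<longrightarrow> z \<in> U) \<and> cb_deriv UNIV \<alpha> \<inter> large_points f \<noteq> {}"
    using \<U> meet unfolding meeting_def by (intro ballI large_points_meet_cb_deriv[OF van]) auto
  then obtain f where f: "\<forall>U\<in>\<U>. (\<forall>z. \<bar>apply_bcontfun (f U) z\<bar> \<le> 1) \<and>
      (\<forall>z. apply_bcontfun (f U) z \<noteq> 0 \<longrightarrow> z \<in> U) \<and> cb_deriv UNIV \<alpha> \<inter> large_points (f U) \<noteq> {}"
    by (rule bchoice[THEN exE])
  have f1: "\<bar>apply_bcontfun (f U) z\<bar> \<le> 1" if "U \<in> \<U>" for U z using f that by blast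
  have overlap: "finite {U \<in> \<U>. apply_bcontfun (f U) z \<noteq> 0} \<and> card {U \<in> \<U>. apply_bcontfun (f U) z \<noteq> 0} \<le> k" for z
  proof -
    have sub: "{U \<in> \<U>. apply_bcontfun (f U) z \<noteq> 0} \<subseteq> {U \<in> \<U>. z \<in> U}" using f by auto
    then show ?thesis using spec[OF k, of z] by (meson card_mono finite_subset order_trans)
  qed
  let ?\<V> = "(\<lambda>U. large_points (f U)) ` \<U>"
  let ?L = "\<lambda>y. {U \<in> \<U>. \<delta> / 2 \<le> norm (T (f U) y)}"
  have half: "0 < \<delta> / 2" using \<delta>_pos by simp
  have fin: "finite (?L y)" for y by (rule finite_large[OF van f1 overlap half])
  have sub: "{W \<in> ?\<V>. y \<in> W} \<subseteq> (\<lambda>U. large_points (f U)) ` ?L y" for y by (auto simp: large_points_def)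
  \<comment> \<open>All \<open>U\<close> with the same image \<open>W\<close> are large at one
    common point of \<open>W\<close>, so the fibres of the assignment are finite and no cardinality
    is lost.\<close>
  have "|\<U>| \<le>o |?\<V>|"
  proof (rule card_of_le_finite_fibres[OF \<open>infinite \<U>\<close>])
    fix W assume "W \<in> ?\<V>"
    then obtain y where "y \<in> W" using f by blast
    then have "{U \<in> \<U>. large_points (f U) = W} \<subseteq> ?L y" by (auto simp: large_points_def)
    then show "finite {U \<in> \<U>. large_points (f U) = W}" using fin by (rule finite_subset)
  qed
  moreover have "point_finite ?\<V>"
    unfolding point_finite_def using finite_subset[OF sub] fin by blast
  moreover have "\<forall>W\<in>?\<V>. open W \<and> W \<noteq> {}" using f open_greater unfolding large_points_def by blast
  moreover have "meeting ?\<V> (cb_deriv UNIV \<alpha>)" using f by (auto simp: meeting_def)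
  moreover have "nontrivial_cotype TYPE('e) \<longrightarrow> point_bounded ?\<V>"
  proof
    assume "nontrivial_cotype TYPE('e)"
    then obtain q C where cotype: "has_cotype TYPE('e) q C" by (auto simp: nontrivial_cotype_iff)
    show "point_bounded ?\<V>"
      unfolding point_bounded_def
    proof (intro exI allI conjI)
      fix y
      show "finite {W \<in> ?\<V>. y \<in> W}" using finite_subset[OF sub] fin by blast
      have "card {W \<in> ?\<V>. y \<in> W} \<le> card ((\<lambda>U. large_points (f U)) ` ?L y)"
        using fin sub by (intro card_mono) auto
      also have "\<dots> \<le> card (?L y)" using fin by (rule card_image_le)
      also have "\<dots> \<le> nat \<lfloor>(C * (M * of_nat k)) powr q / (\<delta> / 2) powr q\<rfloor>"
        by (rule card_large[OF cotype f1 overlap half])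
      finally show "card {W \<in> ?\<V>. y \<in> W} \<le> nat \<lfloor>(C * (M * of_nat k)) powr q / (\<delta> / 2) powr q\<rfloor>" .
    qed
  qed
  ultimately show ?thesis by (rule that)
qed

theorem c_pb_le_c_pf:
  fixes \<alpha> :: "'o::wellorder"
  assumes van: "vanishing_wuc TYPE('e)" and inf: "infinite (cb_deriv (UNIV :: 'k1 set) \<alpha>)"
  shows "c_pb (cb_deriv (UNIV :: 'k1 set) \<alpha>) \<le>o c_pf (cb_deriv (UNIV :: 'k2 set) \<alpha>)"
proof (rule c_pb_le_if_infinite[OF compact1 inf])
  show "Card_order (c_pf (cb_deriv (UNIV :: 'k2 set) \<alpha>))"
    unfolding c_pf_def by (rule Card_order_card_Sup)
  fix \<U> :: "'k1 set set"
  assume \<U>: "infinite \<U>" "point_bounded \<U>" "\<forall>U\<in>\<U>. open U \<and> U \<noteq> {}" "meeting \<U> (cb_deriv UNIV \<alpha>)"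
  obtain \<V> :: "'k2 set set" where \<V>: "|\<U>| \<le>o |\<V>|" "point_finite \<V>"
    "\<forall>W\<in>\<V>. open W \<and> W \<noteq> {}" "meeting \<V> (cb_deriv UNIV \<alpha>)"
    by (rule point_bounded_transfer[OF van \<U>])
  from \<V>(2-4) have "|\<V>| \<le>o c_pf (cb_deriv (UNIV :: 'k2 set) \<alpha>)"
    unfolding c_pf_def by (intro card_Sup_upper) simp
  with \<V>(1) show "|\<U>| \<le>o c_pf (cb_deriv (UNIV :: 'k2 set) \<alpha>)" by (rule ordLeq_transitive)
qed

theorem c_pb_le_c_pb:
  fixes \<alpha> :: "'o::wellorder"
  assumes cotype: "nontrivial_cotype TYPE('e)" and inf: "infinite (cb_deriv (UNIV :: 'k1 set) \<alpha>)"
  shows "c_pb (cb_deriv (UNIV :: 'k1 set) \<alpha>) \<le>o c_pb (cb_deriv (UNIV :: 'k2 set) \<alpha>)"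
proof (rule c_pb_le_if_infinite[OF compact1 inf])
  have van: "vanishing_wuc TYPE('e)"
    using cotype has_cotype_vanishing_wuc by (auto simp: nontrivial_cotype_iff)
  show "Card_order (c_pb (cb_deriv (UNIV :: 'k2 set) \<alpha>))"
    unfolding c_pb_def by (rule Card_order_card_Sup)
  fix \<U> :: "'k1 set set"
  assume \<U>: "infinite \<U>" "point_bounded \<U>" "\<forall>U\<in>\<U>. open U \<and> U \<noteq> {}" "meeting \<U> (cb_deriv UNIV \<alpha>)"
  obtain \<V> :: "'k2 set set" where \<V>: "|\<U>| \<le>o |\<V>|"
    "\<forall>W\<in>\<V>. open W \<and> W \<noteq> {}" "meeting \<V> (cb_deriv UNIV \<alpha>)" "nontrivial_cotype TYPE('e) \<longrightarrow> point_bounded \<V>"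
    by (rule point_bounded_transfer[OF van \<U>])
  from \<V>(2-4) cotype have "|\<V>| \<le>o c_pb (cb_deriv (UNIV :: 'k2 set) \<alpha>)"
    unfolding c_pb_def by (intro card_Sup_upper) simp
  with \<V>(1) show "|\<U>| \<le>o c_pb (cb_deriv (UNIV :: 'k2 set) \<alpha>)" by (rule ordLeq_transitive)
qed

subsection \<open>Discrete sets\<close>

text \<open>An analogue, for the operator \<open>f \<mapsto> T f y\<close>, of the
  \<open>q\<close>-variation of a vector measure over \<open>W\<close>, taken along disjoint
  functions. Cotype keeps it bounded.\<close>

definition variation :: "real \<Rightarrow> 'k2 \<Rightarrow> 'k1 set \<Rightarrow> real"
  where "variation q y W = (SUP F\<in>{F. disjoint_system W F}. \<Sum>f\<in>F. norm (T f y) powr q)"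

text \<open>The analogue of atoms of size at least \<open>\<epsilon>\<close>: no neighbourhood of
  the point is too small to carry a large value at \<open>y\<close>.\<close>

definition charged :: "real \<Rightarrow> 'k2 \<Rightarrow> 'k1 set"
  where "charged \<epsilon> y = {x. \<forall>N. open N \<longrightarrow> x \<in> N \<longrightarrow>
    (\<exists>f. (\<forall>z. \<bar>apply_bcontfun f z\<bar> \<le> 1) \<and> supp f \<subseteq> N \<and> \<epsilon> \<le> norm (T f y))}"

context
  fixes q C assumes cotype: "has_cotype TYPE('e) q C"
begin

lemma disjoint_system_sum_le:
  assumes F: "disjoint_system W F"
  shows "(\<Sum>f\<in>F. norm (T f y) powr q) \<le> (C * M) powr q"
proof -
  have fin: "finite F" using F by (simp add: disjoint_system_def)
  have "(\<Sum>f\<in>F. norm (T f y) powr q) \<le> (C * (M * of_nat 1)) powr q"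
  proof (rule has_cotype_sum_le[OF cotype fin])
    fix s :: "('k1 \<Rightarrow>\<^sub>C real) \<Rightarrow> real"
    assume s: "\<And>f. f \<in> F \<Longrightarrow> \<bar>s f\<bar> \<le> 1"
    show "norm (\<Sum>f\<in>F. s f *\<^sub>R T f y) \<le> M * of_nat 1"
    proof (rule eval_sum_overlap_le[OF fin])
      show "\<bar>apply_bcontfun f z\<bar> \<le> 1" if "f \<in> F" for f z
        using F that by (simp add: disjoint_system_def)
      show "\<bar>s f\<bar> \<le> 1" if "f \<in> F" for f using that by (rule s)
      show "card {f \<in> F. apply_bcontfun f z \<noteq> 0} \<le> 1" for z
        by (rule disjoint_system_overlap[OF F])
    qed
  qed (simp add: M_nonneg)
  then show ?thesis by simp
qed

lemma variation_upper:
  assumes "disjoint_system W F"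
  shows "(\<Sum>f\<in>F. norm (T f y) powr q) \<le> variation q y W"
  unfolding variation_def
proof (rule cSUP_upper)
  show "bdd_above ((\<lambda>F. \<Sum>f\<in>F. norm (T f y) powr q) ` {F. disjoint_system W F})"
    using disjoint_system_sum_le by (intro bdd_aboveI2) auto
qed (use assms in simp)

lemma disjoint_system_empty: "disjoint_system W {}"
  by (simp add: disjoint_system_def)

lemma variation_approx:
  assumes "c < variation q y W"
  obtains F where "disjoint_system W F" "c < (\<Sum>f\<in>F. norm (T f y) powr q)"
proof -
  have "\<exists>F\<in>{F. disjoint_system W F}. c < (\<Sum>f\<in>F. norm (T f y) powr q)"
    using assms disjoint_system_empty[of W] unfolding variation_def
    by (subst (asm) less_cSUP_iff)
      (auto intro!: bdd_aboveI2 disjoint_system_sum_le)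
  then show ?thesis using that by auto
qed

lemma variation_nonneg: "0 \<le> variation q y W"
  using variation_upper[OF disjoint_system_empty, of y W] by simp

lemma variation_le: "variation q y W \<le> (C * M) powr q"
  unfolding variation_def using disjoint_system_empty disjoint_system_sum_le
  by (intro cSUP_least) auto

text \<open>Disjoint neighbourhoods of finitely many charged points carry disjoint functions with
  large values at \<open>y\<close>. The bound is uniform in \<open>y\<close>, as the free set
  argument requires.\<close>

lemma charged_bound:
  assumes \<epsilon>: "0 < \<epsilon>"
  shows "finite (charged \<epsilon> y) \<and> card (charged \<epsilon> y) \<le> nat \<lfloor>(C * (M * of_nat 1)) powr q / \<epsilon> powr q\<rfloor>"
proof (rule finite_if_finite_subsets_card_bdd)
  fix I assume I: "I \<subseteq> charged \<epsilon> y" "finite I"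
  obtain N where N: "\<And>x. x \<in> I \<Longrightarrow> open (N x) \<and> x \<in> N x" "disjoint_family_on N I"
    by (rule finite_disjoint_neighbourhoods[OF I(2)]) (rule that; blast)
  have "\<forall>x\<in>I. \<exists>f. (\<forall>z. \<bar>apply_bcontfun f z\<bar> \<le> 1) \<and> supp f \<subseteq> N x \<and> \<epsilon> \<le> norm (T f y)"
  proof
    fix x assume "x \<in> I"
    then have "x \<in> charged \<epsilon> y" "open (N x)" "x \<in> N x" using I(1) N(1) by auto
    then show "\<exists>f. (\<forall>z. \<bar>apply_bcontfun f z\<bar> \<le> 1) \<and> supp f \<subseteq> N x \<and> \<epsilon> \<le> norm (T f y)"
      unfolding charged_def by simp
  qed
  then obtain f where f: "\<forall>x\<in>I. (\<forall>z. \<bar>apply_bcontfun (f x) z\<bar> \<le> 1) \<and> supp (f x) \<subseteq> N x \<and> \<epsilon> \<le> norm (T (f x) y)"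
    by (rule bchoice[THEN exE])
  have f1: "\<bar>apply_bcontfun (f x) z\<bar> \<le> 1" if "x \<in> I" for x z using f that by blast
  have overlap: "finite {x \<in> I. apply_bcontfun (f x) z \<noteq> 0} \<and> card {x \<in> I. apply_bcontfun (f x) z \<noteq> 0} \<le> 1" for z
  proof -
    have "z \<in> N x" if "x \<in> I" "apply_bcontfun (f x) z \<noteq> 0" for x
      using f that closure_subset[of "{z. apply_bcontfun (f x) z \<noteq> 0}"] by auto
    then have "x = x'" if "x \<in> I" "x' \<in> I" "apply_bcontfun (f x) z \<noteq> 0" "apply_bcontfun (f x') z \<noteq> 0" for x x'
      using that N(2) unfolding disjoint_family_on_def by blast
    then show ?thesis
      using I(2) by (subst One_nat_def, subst card_le_Suc0_iff_eq) auto
  qed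
  have "I = {x \<in> I. \<epsilon> \<le> norm (T (f x) y)}" using f by auto
  then show "card I \<le> nat \<lfloor>(C * (M * of_nat 1)) powr q / \<epsilon> powr q\<rfloor>"
    using card_large[OF cotype f1 overlap \<epsilon>, of y] by simp
qed

text \<open>
  The variation over \<open>Z = (\<Union>d\<in>D. W d) - D\<close> is lower semicontinuous in \<open>y\<close> and superadditive
  over disjoint systems. A bump at \<open>d\<close> that is large at \<open>y\<close> while \<open>d\<close> is not charged by \<open>y\<close>
  yields a new function supported in \<open>W d - {d} \<subseteq> Z\<close>, so it raises the variation.
\<close>

lemma variation_gain:
  fixes f :: "'k1 \<Rightarrow>\<^sub>C real"
  assumes \<epsilon>: "0 < \<epsilon>" and F: "disjoint_system Z F" and c: "c < (\<Sum>g\<in>F. norm (T g y) powr q)"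
    and f: "\<forall>z. \<bar>f z\<bar> \<le> 1" "supp f \<subseteq> W" and W: "W - {d} \<subseteq> Z" "W \<inter> (\<Union>g\<in>F. supp g) = {}"
    and large: "2 * \<epsilon> \<le> norm (T f y)" and d: "d \<notin> charged \<epsilon> y"
  shows "c + \<epsilon> powr q < variation q y Z"
proof -
  obtain N where N: "open N" "d \<in> N"
    and small: "\<forall>f. (\<forall>z. \<bar>apply_bcontfun f z\<bar> \<le> 1) \<longrightarrow> supp f \<subseteq> N \<longrightarrow> norm (T f y) < \<epsilon>"
    using d unfolding charged_def by (simp add: not_le) (meson not_le)
  obtain h :: "'k1 \<Rightarrow>\<^sub>C real" and N' where h: "\<forall>z. 0 \<le> h z \<and> h z \<le> 1" "supp h \<subseteq> N"
    and N': "open N'" "d \<in> N'" "\<forall>z\<in>N'. h z = 1"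
    by (rule bump_function[OF compact1 N])
  obtain f1 where f1: "\<forall>z. apply_bcontfun f1 z = f z * h z"
    by (rule bcontfun_cut_off[OF f(1) h(1)])
  \<comment> \<open>The part \<open>f1\<close> of \<open>f\<close> near \<open>d\<close> costs less
    than \<open>\<epsilon>\<close>, because \<open>d\<close> is not charged. The rest
    \<open>f2\<close> vanishes near \<open>d\<close> and keeps more than
    \<open>\<epsilon>\<close>.\<close>
  define f2 where "f2 = f - f1"
  have f2: "f2 z = f z * (1 - h z)" for z by (simp add: f2_def f1 algebra_simps)
  have "supp f1 \<subseteq> supp h" by (rule closure_mono) (auto simp: f1)
  moreover have "\<forall>z. \<bar>f1 z\<bar> \<le> 1" using f(1) h(1) by (auto simp: f1 abs_mult intro!: mult_le_one)
  ultimately have "norm (T f1 y) < \<epsilon>" using small h(2) by (meson order_trans)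
  moreover have "T f y = T f1 y + T f2 y"
    unfolding f2_def by (simp add: linear_diff[OF linear_eval])
  ultimately have large2: "\<epsilon> < norm (T f2 y)"
    using large norm_triangle_ineq[of "T f1 y" "T f2 y"] by simp
  have f2_le: "\<forall>z. \<bar>f2 z\<bar> \<le> 1" using f(1) h(1) by (auto simp: f2 abs_mult intro!: mult_le_one)
  have "supp f2 \<subseteq> supp f \<inter> - N'"
  proof (rule closure_minimal)
    show "{z. f2 z \<noteq> 0} \<subseteq> supp f \<inter> - N'"
      using N'(3) closure_subset[of "{z. f z \<noteq> 0}"] by (auto simp: f2)
    show "closed (supp f \<inter> - N')" using N'(1) by auto
  qed
  then have supp2: "supp f2 \<subseteq> W - {d}" using f(2) N'(2) by blast
  have zero: "f2 z = 0 \<or> apply_bcontfun g z = 0" if "g \<in> F" for g z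
  proof (rule ccontr)
    assume *: "\<not> (f2 z = 0 \<or> apply_bcontfun g z = 0)"
    then have "z \<in> supp f2" "z \<in> supp g"
      using closure_subset[of "{z. apply_bcontfun f2 z \<noteq> 0}"] closure_subset[of "{z. apply_bcontfun g z \<noteq> 0}"] by auto
    then show False using supp2 W(2) that by blast
  qed
  then have zero': "\<forall>g\<in>F. \<forall>z. f2 z = 0 \<or> apply_bcontfun g z = 0" by blast
  \<comment> \<open>A new term counts only if \<open>f2\<close> is not yet in the set
    \<open>F\<close>; as a member it would be disjoint from itself, hence zero.\<close>
  have "f2 \<notin> F"
  proof
    assume "f2 \<in> F"
    then have "f2 = 0" using zero[of f2] by (intro bcontfun_eqI) auto
    then show False using large2 \<epsilon> linear_0[OF linear_eval, of y] by simp
  qed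
  have fin: "finite F" using F by (simp add: disjoint_system_def)
  have "disjoint_system Z (insert f2 F)"
    using F f2_le supp2 W(1) zero' unfolding disjoint_system_def by auto
  then have "(\<Sum>g\<in>insert f2 F. norm (T g y) powr q) \<le> variation q y Z" by (rule variation_upper)
  moreover have "\<epsilon> powr q \<le> norm (T f2 y) powr q"
    using large2 \<epsilon> cotype by (intro powr_mono2) (auto simp: has_cotype_def)
  ultimately show ?thesis using c \<open>f2 \<notin> F\<close> fin by simp
qed

text \<open>Open sets \<open>G d\<close> isolate the chosen image points: \<open>y d'\<close> in
  \<open>G d\<close> would make the variation at \<open>y d'\<close> exceed that at
  \<open>y d\<close> by more than the pigeonhole class permits.\<close>

theorem discrete_transfer:
  fixes \<alpha> :: "'o::wellorder"
  assumes "infinite D" and DA: "D \<subseteq> cb_deriv (UNIV :: 'k1 set) \<alpha>" and "discrete D"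
  obtains D' where "|D| \<le>o |D'|" "D' \<subseteq> cb_deriv (UNIV :: 'k2 set) \<alpha>" "discrete D'"
proof -
  have q: "2 \<le> q" using cotype by (simp add: has_cotype_def)
  have "\<forall>d\<in>D. \<exists>y. y \<in> peak_images d \<inter> cb_deriv UNIV \<alpha>"
    using peak_images_meet_cb_deriv[OF has_cotype_vanishing_wuc[OF cotype]] DA by blast
  then obtain y where y: "\<forall>d\<in>D. y d \<in> peak_images d \<inter> cb_deriv UNIV \<alpha>" by (rule bchoice[THEN exE])
  have "\<forall>d\<in>D. \<exists>W. open W \<and> W \<inter> D = {d}"
    using \<open>discrete D\<close> by (auto simp: discrete_def isolated_in_def)
  then obtain W where W: "\<forall>d\<in>D. open (W d) \<and> W d \<inter> D = {d}" by (rule bchoice[THEN exE])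
  define Z where "Z = (\<Union>d\<in>D. W d) - D"
  define p where "p d = variation q (y d) Z" for d
  \<comment> \<open>A bump gains \<open>(\<delta> / 4) powr q\<close>, that is
    \<open>2 * \<eta>\<close>: one \<open>\<eta>\<close> pays for approximating the variation, the
    other for the width of the pigeonhole class.\<close>
  define \<eta> where "\<eta> = (\<delta> / 4) powr q / 2"
  have \<eta>: "0 < \<eta>" using \<delta>_pos by (simp add: \<eta>_def)
  define B where "B = nat \<lfloor>(C * M) powr q / \<eta>\<rfloor>"
  have "nat \<lfloor>p d / \<eta>\<rfloor> \<le> B" for d
    unfolding B_def p_def using variation_le \<eta> by (intro nat_mono floor_mono divide_right_mono) auto
  then obtain j where j: "|D| \<le>o |{d \<in> D. nat \<lfloor>p d / \<eta>\<rfloor> = j}|"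
    using infinite_pigeonhole_card_of[of "{..B}" D "\<lambda>d. nat \<lfloor>p d / \<eta>\<rfloor>"] \<open>infinite D\<close> by blast
  define D1 where "D1 = {d \<in> D. nat \<lfloor>p d / \<eta>\<rfloor> = j}"
  have "infinite D1" using j \<open>infinite D\<close> card_of_ordLeq_infinite unfolding D1_def by blast
  have close: "p d' < p d + \<eta>" if "d \<in> D1" "d' \<in> D1" for d d'
  proof -
    have "0 \<le> p d / \<eta>" "0 \<le> p d' / \<eta>"
      using variation_nonneg \<eta> by (auto simp: p_def)
    moreover have "nat \<lfloor>p d' / \<eta>\<rfloor> = nat \<lfloor>p d / \<eta>\<rfloor>" using that by (simp add: D1_def)
    ultimately have "\<lfloor>p d' / \<eta>\<rfloor> = \<lfloor>p d / \<eta>\<rfloor>" by (simp add: eq_nat_nat_iff)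
    then have "p d' / \<eta> < p d / \<eta> + 1" by linarith
    then show ?thesis using \<eta> by (simp add: field_simps)
  qed
  have quarter: "0 < \<delta> / 4" using \<delta>_pos by simp
  \<comment> \<open>Afterwards no \<open>d\<close> in \<open>D2\<close> is charged by the image of
    another point of \<open>D2\<close>. The level \<open>\<delta> / 4\<close> is half of the
    threshold \<open>\<delta> / 2\<close> for bumps, as \<open>variation_gain\<close> needs.\<close>
  obtain D2 where D2: "D2 \<subseteq> D1" "|D1| \<le>o |D2|" "free_set (\<lambda>d. charged (\<delta> / 4) (y d)) D2"
    by (rule free_set_of_full_card[OF \<open>infinite D1\<close> charged_bound[OF quarter]])
  have D2D: "D2 \<subseteq> D" using D2(1) by (auto simp: D1_def)
  have "\<forall>d\<in>D2. \<exists>F. disjoint_system Z F \<and> p d - \<eta> < (\<Sum>g\<in>F. norm (T g (y d)) powr q)"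
  proof
    fix d assume "d \<in> D2"
    have "p d - \<eta> < variation q (y d) Z" using \<eta> by (simp add: p_def)
    then obtain F where "disjoint_system Z F" "p d - \<eta> < (\<Sum>f\<in>F. norm (T f (y d)) powr q)"
      by (rule variation_approx)
    then show "\<exists>F. disjoint_system Z F \<and> p d - \<eta> < (\<Sum>g\<in>F. norm (T g (y d)) powr q)" by blast
  qed
  then obtain F where F: "\<forall>d\<in>D2. disjoint_system Z (F d) \<and> p d - \<eta> < (\<Sum>g\<in>F d. norm (T g (y d)) powr q)"
    by (rule bchoice[THEN exE])
  \<comment> \<open>Removing the supports of \<open>F d\<close> makes a bump at \<open>d\<close>
    disjoint from them; \<open>d\<close> itself stays, as these supports lie in \<open>Z\<close>,
    which avoids \<open>D\<close>.\<close>
  define W' where "W' d = W d - (\<Union>g\<in>F d. supp g)" for d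
  have W': "open (W' d)" "d \<in> W' d" "W' d - {d} \<subseteq> Z" "W' d \<inter> (\<Union>g\<in>F d. supp g) = {}" if "d \<in> D2" for d
  proof -
    have dD: "d \<in> D" using that D2D by blast
    have sys: "disjoint_system Z (F d)" using F that by blast
    then have "closed (\<Union>g\<in>F d. supp g)" unfolding disjoint_system_def by (intro closed_UN) auto
    then show "open (W' d)" unfolding W'_def using W dD by (intro open_Diff) auto
    have "d \<notin> (\<Union>g\<in>F d. supp g)" using sys dD unfolding disjoint_system_def Z_def by blast
    then show "d \<in> W' d" unfolding W'_def using W dD by blast
    show "W' d - {d} \<subseteq> Z" using W dD unfolding W'_def Z_def by blast
    show "W' d \<inter> (\<Union>g\<in>F d. supp g) = {}" unfolding W'_def by blast
  qed
  have "\<forall>d\<in>D2. \<exists>f. f \<in> peaks d \<and> supp f \<subseteq> W' d"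
  proof
    fix d assume "d \<in> D2"
    then obtain f where "f \<in> peaks d" "supp f \<subseteq> W' d"
      using peaks_supported[OF compact1 W'(1,2)] by metis
    then show "\<exists>f. f \<in> peaks d \<and> supp f \<subseteq> W' d" by blast
  qed
  then obtain f where f: "\<forall>d\<in>D2. f d \<in> peaks d \<and> supp (f d) \<subseteq> W' d" by (rule bchoice[THEN exE])
  \<comment> \<open>The fixed system \<open>F d\<close> turns a lower bound on the variation into an
    open condition, which \<open>y d\<close> satisfies.\<close>
  define G where "G d = {z. p d - \<eta> < (\<Sum>g\<in>F d. norm (T g z) powr q)} \<inter> {z. \<delta> / 2 < norm (T (f d) z)}" for d
  have open_G: "open (G d)" for d
    unfolding G_def using q
    by (intro open_Int open_greater open_Collect_less continuous_intros continuous_on_sum continuous_on_powr') auto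
  have in_G: "y d \<in> G d" if "d \<in> D2" for d
  proof -
    have "\<delta> \<le> norm (T (f d) (y d))" using y f D2D that by (auto simp: peak_images_def)
    then show ?thesis using F that \<delta>_pos by (simp add: G_def)
  qed
  have not_in_G: "y d' \<notin> G d" if d: "d \<in> D2" "d' \<in> D2" "d \<noteq> d'" for d d'
  proof
    assume "y d' \<in> G d"
    then have *: "p d - \<eta> < (\<Sum>g\<in>F d. norm (T g (y d')) powr q)" "2 * (\<delta> / 4) \<le> norm (T (f d) (y d'))"
      by (auto simp: G_def)
    have "d \<notin> charged (\<delta> / 4) (y d')" using D2(3) d by (auto simp: free_set_def)
    moreover have "\<forall>z. \<bar>apply_bcontfun (f d) z\<bar> \<le> 1" using f d(1) peak_le_1 by blast
    ultimately have "p d - \<eta> + (\<delta> / 4) powr q < variation q (y d') Z"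
      using variation_gain[OF quarter _ *(1) _ _ W'(3)[OF d(1)] W'(4)[OF d(1)] *(2)] F f d(1) by blast
    moreover have "(\<delta> / 4) powr q = 2 * \<eta>" by (simp add: \<eta>_def)
    ultimately have "p d + \<eta> < p d'" by (simp add: p_def)
    then show False using close[of d d'] D2(1) d by auto
  qed
  have inj: "inj_on y D2" using in_G not_in_G by (metis inj_onI)
  have "|D| \<le>o |D2|" using j D2(2) unfolding D1_def by (rule ordLeq_transitive)
  also have "|D2| \<le>o |y ` D2|" using inj by (intro card_of_ordLeq[THEN iffD1]) blast
  finally have "|D| \<le>o |y ` D2|" .
  moreover have "y ` D2 \<subseteq> cb_deriv UNIV \<alpha>" using y D2D by blast
  moreover have "discrete (y ` D2)"
  proof (rule discreteI)
    fix z assume "z \<in> y ` D2"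
    then obtain d where d: "d \<in> D2" "z = y d" by blast
    then have "G d \<inter> y ` D2 = {z}" using in_G not_in_G by blast
    then show "z isolated_in y ` D2" using d open_G unfolding isolated_in_def by blast
  qed
  ultimately show ?thesis by (rule that)
qed

end

theorem spread_le_spread:
  fixes \<alpha> :: "'o::wellorder"
  assumes cotype: "nontrivial_cotype TYPE('e)" and inf: "infinite (cb_deriv (UNIV :: 'k1 set) \<alpha>)"
  shows "spread (cb_deriv (UNIV :: 'k1 set) \<alpha>) \<le>o spread (cb_deriv (UNIV :: 'k2 set) \<alpha>)"
proof (rule spread_le_if_infinite[OF compact1 inf])
  obtain q C where qC: "has_cotype TYPE('e) q C" using cotype by (auto simp: nontrivial_cotype_iff)
  show "Card_order (spread (cb_deriv (UNIV :: 'k2 set) \<alpha>))"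
    unfolding spread_def by (rule Card_order_card_Sup)
  fix D :: "'k1 set"
  assume D: "infinite D" "D \<subseteq> cb_deriv UNIV \<alpha>" "discrete D"
  obtain D' :: "'k2 set" where D': "|D| \<le>o |D'|" "D' \<subseteq> cb_deriv UNIV \<alpha>" "discrete D'"
    by (rule discrete_transfer[OF qC D])
  from D'(2,3) have "|D'| \<le>o spread (cb_deriv (UNIV :: 'k2 set) \<alpha>)"
    unfolding spread_def by (intro card_Sup_upper) simp
  with D'(1) show "|D| \<le>o spread (cb_deriv (UNIV :: 'k2 set) \<alpha>)" by (rule ordLeq_transitive)
qed

end

section \<open>From the operator norms to the constants of the locale\<close>

lemma norm_le_onorm_inverse:
  assumes "isomorphic_embedding T"
  shows "norm f \<le> onorm_inverse T * norm (T f)"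
proof -
  obtain B where inj: "inj T" and B: "\<forall>y\<in>range T. norm (inv T y) \<le> B * norm y"
    and T: "bounded_linear T"
    using assms unfolding isomorphic_embedding_def by blast
  show ?thesis
  proof (cases "T f = 0")
    case True
    then have "f = 0" using inj bounded_linear.linear[OF T] by (metis injD linear_0)
    then show ?thesis using True by simp
  next
    case False
    have "norm (inv T (T f)) / norm (T f) \<le> onorm_inverse T"
      unfolding onorm_inverse_def
    proof (rule cSUP_upper)
      show "bdd_above ((\<lambda>y. norm (inv T y) / norm y) ` range T)"
      proof (rule bdd_aboveI2)
        fix y assume "y \<in> range T"
        \<comment> \<open>\<open>max B 0\<close> also bounds the quotient at \<open>y = 0\<close>,
          which is 0 by the convention for division.\<close>
        then have "norm (inv T y) \<le> max B 0 * norm y"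
          using B by (meson max.cobounded1 mult_right_mono norm_ge_zero order_trans)
        then show "norm (inv T y) / norm y \<le> max B 0"
          by (cases "y = 0") (auto simp: divide_le_eq)
      qed
    qed simp
    then show ?thesis using False by (simp add: inv_f_f[OF inj] divide_le_eq)
  qed
qed

theorem theorem1p8:
  fixes \<alpha> :: "'o::wellorder"
  assumes "compact (UNIV :: 'k1::t2_space set)"
    and "compact (UNIV :: 'k2::t2_space set)"
    and "\<exists>T :: ('k1 \<Rightarrow>\<^sub>C real) \<Rightarrow> ('k2 \<Rightarrow>\<^sub>C 'e::banach).
           isomorphic_embedding T \<and> onorm T * onorm_inverse T < 3"
    and "infinite (cb_deriv (UNIV :: 'k1 set) \<alpha>)"
  shows "(nontrivial_cotype TYPE('e) \<longrightarrow>
            c_pb (cb_deriv (UNIV :: 'k1 set) \<alpha>) \<le>o c_pb (cb_deriv (UNIV :: 'k2 set) \<alpha>) \<and>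
            spread (cb_deriv (UNIV :: 'k1 set) \<alpha>) \<le>o spread (cb_deriv (UNIV :: 'k2 set) \<alpha>)) \<and>
         (\<not> contains_c0 TYPE('e) \<longrightarrow>
            c_pb (cb_deriv (UNIV :: 'k1 set) \<alpha>) \<le>o c_pf (cb_deriv (UNIV :: 'k2 set) \<alpha>))"
proof -
  obtain T :: "('k1 \<Rightarrow>\<^sub>C real) \<Rightarrow> ('k2 \<Rightarrow>\<^sub>C 'e)"
    where T: "isomorphic_embedding T" and dist: "onorm T * onorm_inverse T < 3"
    using assms(3) by blast
  have bl: "bounded_linear T" using T by (simp add: isomorphic_embedding_def)
  have lower: "norm f \<le> onorm_inverse T * norm (T f)" for f
    by (rule norm_le_onorm_inverse[OF T])
  \<comment> \<open>The nonzero constant function shows that \<open>onorm_inverse T\<close> is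
    positive.\<close>
  have "1 \<le> norm (const_bcontfun 1 :: 'k1 \<Rightarrow>\<^sub>C real)"
    using norm_bounded[of "const_bcontfun 1 :: 'k1 \<Rightarrow>\<^sub>C real" undefined] by simp
  then have "0 < onorm_inverse T * norm (T (const_bcontfun 1))"
    using lower[of "const_bcontfun 1"] by linarith
  then have pos: "0 < onorm_inverse T" by (simp add: zero_less_mult_iff)
  interpret embedding T "onorm_inverse T" "onorm T"
    using assms(1,2) bl lower pos dist onorm[OF bl]
    by (intro embedding.intro) (simp_all add: mult.commute)
  show ?thesis
    using c_pb_le_c_pb[OF _ assms(4)] spread_le_spread[OF _ assms(4)]
      c_pb_le_c_pf[OF not_contains_c0_vanishing_wuc assms(4)] by blast
qed

end
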